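(* Let $X$ and $Y$ be $C^1$ Finsler manifolds modeled on Banach spaces, where $Y$ has smooth norm. Let $f:X\to Y$ be a locally Lipschitz map and let $Jf$ be a strong pseudo-Jacobian mapping for $f$. Then, for each $x\in X$, $$\operatorname{cov} f(x)\ \geq\ C(Jf(x)),$$ where $\operatorname{cov} f(x)$ is the rate of surjection of $f$ near $x$ and $C(Jf(x))$ is the Finsler regularity index of $Jf$ at $x$.
   Context: **Manifolds and charts.** Manifolds are $C^1$ manifolds modeled on (possibly infinite-dimensional) real Banach spaces. A chart $(W,\varphi)$ at $x\in X$ is an open set $W\ni x$ with a chart map $\varphi$ from $W$ onto an open subset of the model space $E$; $d\varphi^{-1}(\varphi(x)):E\to T_xX$ is the induced linear isomorphism. $\mathcal L(E,F)$ denotes the bounded linear operators. **Finsler manifolds.** A Finsler structure on $X$ (modeled on $(E,|\cdot|_E)$) is a continuous map $\|\cdot\|:TX\to[0,\infty)$ such that: (1) for each $x$, its restriction $\|\cdot\|_x$ to $T_xX$ is a norm such that for every chart $(W,\varphi)$ at $x$, $\|d\varphi^{-1}(\varphi(x))(\cdot)\|_x$ is a norm on $E$ equivalent to $|\cdot|_E$; (2) for each $x_0\in X$, chart $(W,\varphi)$ at $x_0$ and $\varepsilon>0$ there is an open neighborhood $U\subset W$ of $x_0$ with $\frac1{1+\varepsilon}\|d\varphi^{-1}(\varphi(x_0))\mathbf v\|_{x_0}\le\|d\varphi^{-1}(\varphi(x))\mathbf v\|_x\le(1+\varepsilon)\|d\varphi^{-1}(\varphi(x_0))\mathbf v\|_{x_0}$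 for all $x\in U$, $\mathbf v\in E$. A Finsler manifold is a $C^1$ Banach manifold with a Finsler structure; all Finsler manifolds are assumed connected. $d_X(u,u')$ is the infimum of the lengths $\int_a^b\|\dot\sigma(t)\|_{\sigma(t)}dt$ of $C^1$ paths $\sigma$ joining $u$ to $u'$; $B_X(x;r)$ is the open $d_X$-ball. $X$ has smooth norm if each $\|\cdot\|_x$ is Fréchet differentiable away from $0$. Locally Lipschitz means with respect to $d_X,d_Y$ (equivalently, in charts). **Pseudo-Jacobians.** For Banach spaces $E,F$, $U\subset E$ open and $\mathbf f:U\to F$ continuous, a nonempty set $J\mathbf f(\mathbf x)\subset\mathcal L(E,F)$ is a pseudo-Jacobian of $\mathbf f$ at $\mathbf x\in U$ if for all $y^*\in F^*$, $v\in E$: $\limsup_{t\to0^+}\frac{y^*(\mathbf f(\mathbf x+tv))-y^*(\mathbf f(\mathbf x))}{t}\le\sup\{\langle y^*,T(v)\rangle:T\in J\mathbf f(\mathbf x)\}$. A set-valued map $J\mathbf f:U\to2^{\mathcal L(E,F)}$ is a pseudo-Jacobian mapping if this holds at every point; it is locally bounded if each point has a ball $B\subset U$ around it with $\bigcup_{\mathbf z\in B}J\mathbf f(\mathbf z)$ norm bounded. Let $f:X\to Y$ be locally Lipschitz between $C^1$ manifolds modeled on $E,F$. An assignment $x\mapsto Jf(x)$, with $Jf(x)$ a set of linear operators $T_xX\to T_{f(x)}Y$, is a pseudo-Jacobian mapping for $f$ if for each $x\in X$ there are charts $(W,\varphi)$ at $x$ and $(V,\psi)$ at $f(x)$ with $f(W)\subset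 V$ and a locally bounded pseudo-Jacobian mapping $J\mathbf f:\varphi(W)\to2^{\mathcal L(E,F)}$ of $\mathbf f=\psi\circ f\circ\varphi^{-1}$ such that $Jf(u)=d\psi^{-1}(\psi(f(u)))\,J\mathbf f(\varphi(u))\,[d\varphi^{-1}(\varphi(u))]^{-1}$ for all $u\in W$. It is strong if in addition the charts can be chosen so that each $J\mathbf f(\mathbf u)$, $\mathbf u\in\varphi(W)$, is convex and compact in the weak operator topology. **Finsler regularity index.** For $T\in\mathcal L(T_xX,T_{f(x)}Y)$ let $C_{\rm Finsler}(T)=\inf_{|y^*|_{f(x)}=1}|T^*y^*|_x$, with $|\cdot|_x,|\cdot|_{f(x)}$ the dual norms of $\|\cdot\|_x,\|\cdot\|_{f(x)}$. Set $C(Jf(x)):=\sup_{R>0}\inf\{C_{\rm Finsler}(T):T\in\mathrm{co}\,Jf(B_X(x;R))\}$, where co is the convex hull and $Jf(B_X(x;R))=\bigcup_{u\in B_X(x;R)}Jf(u)$ is regarded (for small $R$) as a subset of $\mathcal L(T_xX,T_{f(x)}Y)$ by means of a pair of charts $(W,\varphi)$ at $x$ and $(V,\psi)$ at $f(x)$ with $f(W)\subset V$ for which there is a locally bounded pseudo-Jacobian mapping $J\mathbf f:\varphi(W)\to2^{\mathcal L(E,F)}$ of $\mathbf f=\psi\circ f\circ\varphi^{-1}$ such that $Jf(u)=d\psi^{-1}(\psi(f(u)))\,J\mathbf f(\varphi(u))\,[d\varphi^{-1}(\varphi(u))]^{-1}$ for all $u\in W$: the operator of $Jf(u)$ represented by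 $\mathbf T\in J\mathbf f(\varphi(u))$ is identified with $d\psi^{-1}(\psi(f(x)))\,\mathbf T\,[d\varphi^{-1}(\varphi(x))]^{-1}$. (The value does not depend on the charts.) **Rate of surjection.** $\operatorname{cov} f(x)$ is the supremum of all $\alpha>0$ for which there is a neighborhood $W_x$ of $x$ with $B_Y(f(u);\alpha r)\subset f(B_X(u;r))$ for all $u\in W_x$ and $r>0$ with $B_X(u;r)\subset W_x$ (equal to $0$ if there is no such $\alpha$). *)

theory Defs
  imports "HOL-Analysis.Analysis"
begin

section \<open>C1 Banach manifolds\<close>

text \<open>A manifold is a Hausdorff space, given as a type, together with its maximal C1 atlas.
  A chart is a pair of its domain and its chart map; values of the chart map outside the domain
  are irrelevant.\<close>

type_synonym ('x, 'e) chart = "'x set \<times> ('x \<Rightarrow> 'e)"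

abbreviation dom_chart :: "('x, 'e) chart \<Rightarrow> 'x set"
  where "dom_chart \<equiv> fst"

abbreviation map_chart :: "('x, 'e) chart \<Rightarrow> 'x \<Rightarrow> 'e"
  where "map_chart \<equiv> snd"

definition inv_chart :: "('x, 'e) chart \<Rightarrow> 'e \<Rightarrow> 'x"
  where "inv_chart c = inv_into (dom_chart c) (map_chart c)"

definition img_chart :: "('x, 'e) chart \<Rightarrow> 'e set"
  where "img_chart c = map_chart c ` dom_chart c"

definition is_chart :: "('x::topological_space, 'e::real_normed_vector) chart \<Rightarrow> bool"
  where "is_chart c \<longleftrightarrow> open (dom_chart c) \<and> open (img_chart c) \<and>
    homeomorphism (dom_chart c) (img_chart c) (map_chart c) (inv_chart c)"

definition C1_on :: "'a::real_normed_vector set \<Rightarrow> ('a \<Rightarrow> 'b::real_normed_vector) \<Rightarrow> bool"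
  where "C1_on S g \<longleftrightarrow> (\<exists>g' :: 'a \<Rightarrow> 'a \<Rightarrow>\<^sub>L 'b.
    (\<forall>z\<in>S. (g has_derivative blinfun_apply (g' z)) (at z)) \<and> continuous_on S g')"

definition C1_compatible ::
    "('x, 'e::real_normed_vector) chart \<Rightarrow> ('x, 'e) chart \<Rightarrow> bool"
  where "C1_compatible c c' \<longleftrightarrow>
    C1_on (map_chart c ` (dom_chart c \<inter> dom_chart c')) (map_chart c' \<circ> inv_chart c) \<and>
    C1_on (map_chart c' ` (dom_chart c \<inter> dom_chart c')) (map_chart c \<circ> inv_chart c')"

definition C1_manifold :: "('x::t2_space, 'e::banach) chart set \<Rightarrow> bool"
  where "C1_manifold A \<longleftrightarrow>
    (\<forall>c\<in>A. is_chart c) \<and>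
    (\<Union>c\<in>A. dom_chart c) = UNIV \<and>
    (\<forall>c\<in>A. \<forall>c'\<in>A. C1_compatible c c') \<and>
    (\<forall>c. is_chart c \<and> (\<forall>c'\<in>A. C1_compatible c c') \<longrightarrow> c \<in> A)"

definition charts_at :: "('x, 'e) chart set \<Rightarrow> 'x \<Rightarrow> ('x, 'e) chart set"
  where "charts_at A x = {c \<in> A. x \<in> dom_chart c}"


section \<open>Tangent spaces\<close>

text \<open>A tangent vector at \<open>x\<close> is an equivalence class of pairs of a chart at \<open>x\<close> and a vector of
  the model space, two pairs being equivalent if the derivative of the change of charts
  maps one vector to the other. Such a class contains exactly one pair for each chart at \<open>x\<close>, so it
  is represented by the function sending a chart at \<open>x\<close> to the coordinate vector in that chart
  (and anything else to 0).\<close>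

type_synonym ('x, 'e) tangent = "('x, 'e) chart \<Rightarrow> 'e"

text \<open>\<open>dinv_chart A c x\<close> is the isomorphism from the model space onto the tangent space at \<open>x\<close>
  given by the derivative of the inverse of the chart map of \<open>c\<close>. Its inverse is \<open>\<lambda>\<xi>. \<xi> c\<close>.\<close>

definition dinv_chart ::
    "('x, 'e::real_normed_vector) chart set \<Rightarrow> ('x, 'e) chart \<Rightarrow> 'x \<Rightarrow> 'e \<Rightarrow> ('x, 'e) tangent"
  where "dinv_chart A c x v =
    (\<lambda>c'. if c' \<in> charts_at A x
          then frechet_derivative (map_chart c' \<circ> inv_chart c) (at (map_chart c x)) v
          else 0)"

definition tangent_space ::
    "('x, 'e::real_normed_vector) chart set \<Rightarrow> 'x \<Rightarrow> ('x, 'e) tangent set"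
  where "tangent_space A x = (\<Union>c\<in>charts_at A x. range (dinv_chart A c x))"


section \<open>Finsler manifolds\<close>

definition is_norm :: "('e::real_vector \<Rightarrow> real) \<Rightarrow> bool"
  where "is_norm p \<longleftrightarrow>
    (\<forall>v. 0 \<le> p v) \<and> (\<forall>v. p v = 0 \<longleftrightarrow> v = 0) \<and>
    (\<forall>a v. p (a *\<^sub>R v) = \<bar>a\<bar> * p v) \<and> (\<forall>v w. p (v + w) \<le> p v + p w)"

definition equivalent_norm :: "('e::real_normed_vector \<Rightarrow> real) \<Rightarrow> bool"
  where "equivalent_norm p \<longleftrightarrow>
    (\<exists>a>0. \<exists>b>0. \<forall>v. a * norm v \<le> p v \<and> p v \<le> b * norm v)"

text \<open>The linear structure of a tangent space, and the topology of the tangent bundle, are the ones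
  transported by the maps \<open>dinv_chart A c x\<close>; accordingly, being a norm (on the tangent space) and
  being continuous (on the tangent bundle) are expressed in charts.\<close>

definition finsler_structure ::
    "('x::t2_space, 'e::banach) chart set \<Rightarrow> ('x \<Rightarrow> ('x, 'e) tangent \<Rightarrow> real) \<Rightarrow> bool"
  where "finsler_structure A N \<longleftrightarrow>
    (\<forall>c\<in>A. continuous_on (dom_chart c \<times> UNIV) (\<lambda>(x, v). N x (dinv_chart A c x v))) \<and>
    (\<forall>x. \<forall>c\<in>charts_at A x.
       is_norm (\<lambda>v. N x (dinv_chart A c x v)) \<and>
       equivalent_norm (\<lambda>v. N x (dinv_chart A c x v))) \<and>
    (\<forall>x0. \<forall>c\<in>charts_at A x0. \<forall>\<epsilon>>0.
       \<exists>U. open U \<and> x0 \<in> U \<and> U \<subseteq> dom_chart c \<and>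
         (\<forall>x\<in>U. \<forall>v.
            1 / (1 + \<epsilon>) * N x0 (dinv_chart A c x0 v) \<le> N x (dinv_chart A c x v) \<and>
            N x (dinv_chart A c x v) \<le> (1 + \<epsilon>) * N x0 (dinv_chart A c x0 v)))"

definition finsler_manifold ::
    "('x::t2_space, 'e::banach) chart set \<Rightarrow> ('x \<Rightarrow> ('x, 'e) tangent \<Rightarrow> real) \<Rightarrow> bool"
  where "finsler_manifold A N \<longleftrightarrow>
    C1_manifold A \<and> finsler_structure A N \<and> connected (UNIV :: 'x set)"

definition smooth_norm ::
    "('x, 'e::banach) chart set \<Rightarrow> ('x \<Rightarrow> ('x, 'e) tangent \<Rightarrow> real) \<Rightarrow> bool"
  where "smooth_norm A N \<longleftrightarrow>
    (\<forall>x. \<forall>c\<in>charts_at A x. \<forall>v. v \<noteq> 0 \<longrightarrow>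
       (\<lambda>w. N x (dinv_chart A c x w)) differentiable (at v))"

definition C1_path ::
    "('x::t2_space, 'e::banach) chart set \<Rightarrow> real \<Rightarrow> real \<Rightarrow> (real \<Rightarrow> 'x) \<Rightarrow> bool"
  where "C1_path A a b \<sigma> \<longleftrightarrow> a < b \<and> continuous_on {a..b} \<sigma> \<and>
    (\<forall>c\<in>A. \<exists>D. continuous_on {t \<in> {a..b}. \<sigma> t \<in> dom_chart c} D \<and>
       (\<forall>t\<in>{a..b}. \<sigma> t \<in> dom_chart c \<longrightarrow>
          ((map_chart c \<circ> \<sigma>) has_vector_derivative D t) (at t within {a..b})))"

definition velocity ::
    "('x, 'e::banach) chart set \<Rightarrow> real \<Rightarrow> real \<Rightarrow> (real \<Rightarrow> 'x) \<Rightarrow> real \<Rightarrow> ('x, 'e) tangent"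
  where "velocity A a b \<sigma> t =
    (\<lambda>c. if c \<in> charts_at A (\<sigma> t)
         then vector_derivative (map_chart c \<circ> \<sigma>) (at t within {a..b}) else 0)"

definition path_len ::
    "('x, 'e::banach) chart set \<Rightarrow> ('x \<Rightarrow> ('x, 'e) tangent \<Rightarrow> real) \<Rightarrow>
     real \<Rightarrow> real \<Rightarrow> (real \<Rightarrow> 'x) \<Rightarrow> real"
  where "path_len A N a b \<sigma> = integral {a..b} (\<lambda>t. N (\<sigma> t) (velocity A a b \<sigma> t))"

definition finsler_dist ::
    "('x::t2_space, 'e::banach) chart set \<Rightarrow> ('x \<Rightarrow> ('x, 'e) tangent \<Rightarrow> real) \<Rightarrow>
     'x \<Rightarrow> 'x \<Rightarrow> real"
  where "finsler_dist A N u u' =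
    Inf {path_len A N a b \<sigma> | a b \<sigma>. C1_path A a b \<sigma> \<and> \<sigma> a = u \<and> \<sigma> b = u'}"

definition finsler_ball ::
    "('x::t2_space, 'e::banach) chart set \<Rightarrow> ('x \<Rightarrow> ('x, 'e) tangent \<Rightarrow> real) \<Rightarrow>
     'x \<Rightarrow> real \<Rightarrow> 'x set"
  where "finsler_ball A N x r = {u. finsler_dist A N x u < r}"

definition locally_lipschitz ::
    "('x::t2_space, 'e::banach) chart set \<Rightarrow> ('x \<Rightarrow> ('x, 'e) tangent \<Rightarrow> real) \<Rightarrow>
     ('y::t2_space, 'f::banach) chart set \<Rightarrow> ('y \<Rightarrow> ('y, 'f) tangent \<Rightarrow> real) \<Rightarrow>
     ('x \<Rightarrow> 'y) \<Rightarrow> bool"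
  where "locally_lipschitz A N B M f \<longleftrightarrow>
    (\<forall>x. \<exists>U L. open U \<and> x \<in> U \<and>
       (\<forall>u\<in>U. \<forall>u'\<in>U. finsler_dist B M (f u) (f u') \<le> L * finsler_dist A N u u'))"


section \<open>Pseudo-Jacobians\<close>

definition pseudo_jacobian ::
    "('e::banach \<Rightarrow> 'f::banach) \<Rightarrow> 'e \<Rightarrow> ('e \<Rightarrow>\<^sub>L 'f) set \<Rightarrow> bool"
  where "pseudo_jacobian g z J \<longleftrightarrow> J \<noteq> {} \<and>
    (\<forall>(y :: 'f \<Rightarrow>\<^sub>L real) v.
       Limsup (at_right 0) (\<lambda>t. ereal ((blinfun_apply y (g (z + t *\<^sub>R v)) - blinfun_apply y (g z)) / t))
       \<le> (SUP T\<in>J. ereal (blinfun_apply y (blinfun_apply T v))))"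

definition pseudo_jacobian_map ::
    "'e set \<Rightarrow> ('e::banach \<Rightarrow> 'f::banach) \<Rightarrow> ('e \<Rightarrow> ('e \<Rightarrow>\<^sub>L 'f) set) \<Rightarrow> bool"
  where "pseudo_jacobian_map U g J \<longleftrightarrow>
    open U \<and> continuous_on U g \<and> (\<forall>z\<in>U. pseudo_jacobian g z (J z))"

definition locally_bounded ::
    "'e set \<Rightarrow> ('e::banach \<Rightarrow> ('e \<Rightarrow>\<^sub>L 'f::banach) set) \<Rightarrow> bool"
  where "locally_bounded U J \<longleftrightarrow>
    (\<forall>z\<in>U. \<exists>r>0. ball z r \<subseteq> U \<and> bounded (\<Union>w\<in>ball z r. J w))"

text \<open>The topology induced by the functionals \<open>T \<mapsto> y (T v)\<close>; on the function space,
  \<open>euclidean\<close> is the product topology.\<close>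

definition weak_operator_topology ::
    "('e::real_normed_vector \<Rightarrow>\<^sub>L 'f::real_normed_vector) topology"
  where "weak_operator_topology =
    pullback_topology UNIV
      (\<lambda>T (v, y :: 'f \<Rightarrow>\<^sub>L real). blinfun_apply y (blinfun_apply T v)) euclidean"

text \<open>The operator between the tangent spaces at \<open>u\<close> and \<open>w\<close> which is represented by \<open>T\<close> in the
  charts \<open>c\<close> and \<open>d\<close>. Restricting it to the tangent space makes equality of such functions
  coincide with equality of operators.\<close>

definition tangent_op ::
    "('x, 'e::banach) chart set \<Rightarrow> ('y, 'f::banach) chart set \<Rightarrow>
     ('x, 'e) chart \<Rightarrow> ('y, 'f) chart \<Rightarrow> 'x \<Rightarrow> 'y \<Rightarrow> ('e \<Rightarrow>\<^sub>L 'f) \<Rightarrow>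
     ('x, 'e) tangent \<Rightarrow> ('y, 'f) tangent"
  where "tangent_op A B c d u w T =
    (\<lambda>\<xi>\<in>tangent_space A u. dinv_chart B d w (blinfun_apply T (\<xi> c)))"

definition jacobian_in_charts ::
    "('x, 'e::banach) chart set \<Rightarrow> ('y, 'f::banach) chart set \<Rightarrow> ('x \<Rightarrow> 'y) \<Rightarrow>
     ('x \<Rightarrow> (('x, 'e) tangent \<Rightarrow> ('y, 'f) tangent) set) \<Rightarrow>
     ('x, 'e) chart \<Rightarrow> ('y, 'f) chart \<Rightarrow> ('e \<Rightarrow> ('e \<Rightarrow>\<^sub>L 'f) set) \<Rightarrow> bool"
  where "jacobian_in_charts A B f Jf c d J \<longleftrightarrow>
    c \<in> A \<and> d \<in> B \<and> f ` dom_chart c \<subseteq> dom_chart d \<and>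
    pseudo_jacobian_map (img_chart c) (map_chart d \<circ> f \<circ> inv_chart c) J \<and>
    locally_bounded (img_chart c) J \<and>
    (\<forall>u\<in>dom_chart c. Jf u = tangent_op A B c d u (f u) ` J (map_chart c u))"

definition strong_pseudo_jacobian_mapping ::
    "('x, 'e::banach) chart set \<Rightarrow> ('y, 'f::banach) chart set \<Rightarrow> ('x \<Rightarrow> 'y) \<Rightarrow>
     ('x \<Rightarrow> (('x, 'e) tangent \<Rightarrow> ('y, 'f) tangent) set) \<Rightarrow> bool"
  where "strong_pseudo_jacobian_mapping A B f Jf \<longleftrightarrow>
    (\<forall>x. \<exists>c d J. x \<in> dom_chart c \<and> jacobian_in_charts A B f Jf c d J \<and>
       (\<forall>z\<in>img_chart c. convex (J z) \<and> compactin weak_operator_topology (J z)))"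


section \<open>Finsler regularity index and rate of surjection\<close>

text \<open>Only the values of a functional on the tangent space matter.\<close>

definition cotangent_space ::
    "('x, 'e::banach) chart set \<Rightarrow> 'x \<Rightarrow> (('x, 'e) tangent \<Rightarrow> real) set"
  where "cotangent_space A x =
    {\<eta>. \<forall>c\<in>charts_at A x. bounded_linear (\<lambda>v. \<eta> (dinv_chart A c x v))}"

definition dual_norm ::
    "('x, 'e::banach) chart set \<Rightarrow> ('x \<Rightarrow> ('x, 'e) tangent \<Rightarrow> real) \<Rightarrow> 'x \<Rightarrow>
     (('x, 'e) tangent \<Rightarrow> real) \<Rightarrow> real"
  where "dual_norm A N x \<eta> = (SUP \<xi>\<in>{\<xi> \<in> tangent_space A x. N x \<xi> \<le> 1}. \<bar>\<eta> \<xi>\<bar>)"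

text \<open>The infimum is taken in the extended reals; it is infinite if the tangent space at \<open>y\<close> is
  trivial, as there are then no functionals of norm 1.\<close>

definition C_finsler ::
    "('x, 'e::banach) chart set \<Rightarrow> ('x \<Rightarrow> ('x, 'e) tangent \<Rightarrow> real) \<Rightarrow>
     ('y, 'f::banach) chart set \<Rightarrow> ('y \<Rightarrow> ('y, 'f) tangent \<Rightarrow> real) \<Rightarrow>
     'x \<Rightarrow> 'y \<Rightarrow> (('x, 'e) tangent \<Rightarrow> ('y, 'f) tangent) \<Rightarrow> ereal"
  where "C_finsler A N B M x y T =
    (INF \<eta>\<in>{\<eta> \<in> cotangent_space B y. dual_norm B M y \<eta> = 1}. ereal (dual_norm A N x (\<eta> \<circ> T)))"

text \<open>The index is computed from a representation \<open>J\<close> of the pseudo-Jacobian mapping in charts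
  \<open>c\<close>, \<open>d\<close> (see \<open>jacobian_in_charts\<close>), where \<open>x\<close> is in the domain of \<open>c\<close>. The operators at points
  \<open>u\<close> near \<open>x\<close> are transported to \<open>x\<close> through their representatives in \<open>J\<close>; as \<open>tangent_op\<close> is
  linear in its operator argument, the convex hull may be taken among the representatives.\<close>

definition finsler_regularity_index ::
    "('x::t2_space, 'e::banach) chart set \<Rightarrow> ('x \<Rightarrow> ('x, 'e) tangent \<Rightarrow> real) \<Rightarrow>
     ('y::t2_space, 'f::banach) chart set \<Rightarrow> ('y \<Rightarrow> ('y, 'f) tangent \<Rightarrow> real) \<Rightarrow>
     ('x \<Rightarrow> 'y) \<Rightarrow> ('x, 'e) chart \<Rightarrow> ('y, 'f) chart \<Rightarrow> ('e \<Rightarrow> ('e \<Rightarrow>\<^sub>L 'f) set) \<Rightarrow> 'x \<Rightarrow> ereal"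
  where "finsler_regularity_index A N B M f c d J x =
    (SUP R\<in>{R. 0 < R \<and> finsler_ball A N x R \<subseteq> dom_chart c}.
       INF T\<in>convex hull (\<Union>u\<in>finsler_ball A N x R. J (map_chart c u)).
         C_finsler A N B M x (f x) (tangent_op A B c d x (f x) T))"

definition cov ::
    "('x::t2_space, 'e::banach) chart set \<Rightarrow> ('x \<Rightarrow> ('x, 'e) tangent \<Rightarrow> real) \<Rightarrow>
     ('y::t2_space, 'f::banach) chart set \<Rightarrow> ('y \<Rightarrow> ('y, 'f) tangent \<Rightarrow> real) \<Rightarrow>
     ('x \<Rightarrow> 'y) \<Rightarrow> 'x \<Rightarrow> ereal"
  where "cov A N B M f x =
    Sup (insert 0 {ereal \<alpha> | \<alpha>. 0 < \<alpha> \<and>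
      (\<exists>W. open W \<and> x \<in> W \<and>
         (\<forall>u\<in>W. \<forall>r>0. finsler_ball A N u r \<subseteq> W \<longrightarrow>
            finsler_ball B M (f u) (\<alpha> * r) \<subseteq> f ` finsler_ball A N u r))})"

end

(* Near x the Finsler norms are (1 + epsilon)-close to fixed norms q and p on the model spaces, so the
   question reduces to covering for the local representative g of f. If g z is not w, the derivative
   y* of p at w - g z is a functional of dual norm 1. Since J z is convex and compact in the weak
   operator topology, a minimax argument turns the lower bounds |T* y*| > kappa, T in J z, into a
   single direction v in the q-unit ball with y* (T v) >= kappa for all T in J z; by the
   pseudo-Jacobian inequality for -y*, the function p (w - g _) decreases along v at rate kappa.
   Ekeland's variational principle then produces a solution of g z = w at q-distance at most
   p (w - g z) / kappa'. *)

theory Submission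
  imports Defs
begin

section \<open>Covering in Banach spaces\<close>

text \<open>Three obstacles shape the proof. Hypotheses and conclusion use distances that are infima
  over all C1 paths of the manifold, so near \<open>x\<close> these must be compared with
  \<open>q\<close> and \<open>p\<close>: coordinate segments give upper bounds, and the fact that a
  short path cannot leave a coordinate ball gives lower bounds. Convexity and compactness are
  available only in charts that may differ from the charts \<open>c\<close>, \<open>d\<close> of the
  index; the minimax argument therefore works with the functions \<open>v \<mapsto> y (T v)\<close>
  in the product topology, which are easily carried from one pair of charts to another. Finally, a
  pseudo-Jacobian controls only one-sided upper limits of scalar functions; differentiability of the
  norm turns this into a decrease of \<open>p (w - g _)\<close>, with a remainder that the Lipschitz
  condition makes negligible. Two strict gaps are opened: \<open>\<kappa>' < \<kappa>\<close> pays
  for that remainder, and \<open>\<alpha> < \<kappa>'\<close> pays for replacing the Finsler norms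
  at nearby points by \<open>q\<close> and \<open>p\<close>, which costs a factor
  \<open>1 + \<epsilon>\<close> twice.\<close>

locale renorming =
  fixes p :: "'e::real_normed_vector \<Rightarrow> real"
  assumes is_norm: "is_norm p" and equivalent: "equivalent_norm p"
begin

section \<open>Equivalent norms: topology, completeness, derivatives, mean value inequality\<close>

lemma nonneg [simp]: "0 \<le> p v"
  and eq_zero [simp]: "p v = 0 \<longleftrightarrow> v = 0"
  and scaleR [simp]: "p (a *\<^sub>R v) = \<bar>a\<bar> * p v"
  and triangle: "p (v + w) \<le> p v + p w"
  using is_norm unfolding is_norm_def by blast+

lemma zero [simp]: "p 0 = 0"
  by simp

lemma minus [simp]: "p (- v) = p v"
  using scaleR [of "-1" v] by simp

lemma minus_commute: "p (v - w) = p (w - v)"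
  using minus [of "v - w"] by simp

lemma triangle_diff: "p (u - w) \<le> p (u - v) + p (v - w)"
  using triangle [of "u - v" "v - w"] by simp

lemma pos: "v \<noteq> 0 \<Longrightarrow> 0 < p v"
  using nonneg [of v] by (simp add: less_le)

lemma upper_bound: obtains b where "0 < b" "\<And>v. p v \<le> b * norm v"
  using equivalent unfolding equivalent_norm_def by blast

lemma lower_bound: obtains a where "0 < a" "\<And>v. norm v \<le> a * p v"
proof -
  obtain a where a: "0 < a" "\<And>v. a * norm v \<le> p v"
    using equivalent unfolding equivalent_norm_def by blast
  show ?thesis
    by (rule that [of "1 / a"]) (use a in \<open>simp_all add: field_simps\<close>)
qed

lemma continuous_on: "continuous_on S p"
proof -
  obtain b where b: "0 < b" "\<And>v. p v \<le> b * norm v"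
    by (rule upper_bound) blast
  have "b-lipschitz_on UNIV p"
  proof (rule lipschitz_onI)
    fix v w
    have "p v \<le> p w + p (v - w)" "p w \<le> p v + p (v - w)"
      using triangle [of w "v - w"] triangle [of v "w - v"] minus_commute [of v w] by auto
    then show "dist (p v) (p w) \<le> b * dist v w"
      using b(2) [of "v - w"] by (simp add: dist_norm)
  qed (use b in simp)
  then show ?thesis
    using lipschitz_on_continuous_on continuous_on_subset by blast
qed

lemma continuous_on_compose [continuous_intros]:
  "continuous_on S g \<Longrightarrow> continuous_on S (\<lambda>x. p (g x))"
  using continuous_on_compose2 [OF continuous_on [of UNIV]] by auto

lemma tendsto [tendsto_intros]: "(g \<longlongrightarrow> l) F \<Longrightarrow> ((\<lambda>x. p (g x)) \<longlongrightarrow> p l) F"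
  using continuous_on [of UNIV] continuous_on_tendsto_compose [of UNIV p g l F] by auto

lemma open_ball: "open {z. p (z - z0) < r}"
  by (intro open_Collect_less continuous_intros)

lemma ball_in_open:
  assumes "open U" "z0 \<in> U"
  obtains r where "0 < r" "{z. p (z - z0) < r} \<subseteq> U"
proof -
  obtain a where a: "0 < a" "\<And>v. norm v \<le> a * p v"
    by (rule lower_bound) blast
  obtain e where e: "0 < e" "ball z0 e \<subseteq> U"
    using assms open_contains_ball by blast
  have "{z. p (z - z0) < e / a} \<subseteq> ball z0 e"
  proof
    fix z assume "z \<in> {z. p (z - z0) < e / a}"
    then have "a * p (z - z0) < e"
      using a by (simp add: field_simps)
    then show "z \<in> ball z0 e"
      using a(2) [of "z - z0"] by (simp add: dist_norm norm_minus_commute)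
  qed
  then show ?thesis
    using that [of "e / a"] a e by auto
qed

lemma convex_ball: "convex {z. p (z - z0) < r}"
proof (rule convexI)
  fix x y and u v :: real
  assume x: "x \<in> {z. p (z - z0) < r}" and y: "y \<in> {z. p (z - z0) < r}"
    and uv: "0 \<le> u" "0 \<le> v" "u + v = 1"
  have eq: "u *\<^sub>R x + v *\<^sub>R y - z0 = u *\<^sub>R (x - z0) + v *\<^sub>R (y - z0)"
    using uv by (simp add: algebra_simps flip: scaleR_left_distrib)
  have "p (u *\<^sub>R x + v *\<^sub>R y - z0) \<le> u * p (x - z0) + v * p (y - z0)"
    unfolding eq using triangle [of "u *\<^sub>R (x - z0)" "v *\<^sub>R (y - z0)"] uv by simp
  also have "\<dots> < r"
    using convex_bound_lt [of "p (x - z0)" r "p (y - z0)" u v] x y uv by simp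
  finally show "u *\<^sub>R x + v *\<^sub>R y \<in> {z. p (z - z0) < r}"
    by simp
qed

lemma convex_unit_ball: "convex {z. p z \<le> 1}"
proof (rule convexI)
  fix x y and u v :: real
  assume x: "x \<in> {z. p z \<le> 1}" and y: "y \<in> {z. p z \<le> 1}"
    and uv: "0 \<le> u" "0 \<le> v" "u + v = 1"
  have "p (u *\<^sub>R x + v *\<^sub>R y) \<le> u * p x + v * p y"
    using triangle [of "u *\<^sub>R x" "v *\<^sub>R y"] uv by simp
  also have "\<dots> \<le> 1"
    using convex_bound_le [of "p x" 1 "p y" u v] x y uv by simp
  finally show "u *\<^sub>R x + v *\<^sub>R y \<in> {z. p z \<le> 1}"
    by simp
qed

text \<open>Completeness is used twice through this criterion: \<open>r\<close> is the sequence of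
  values of the function in Ekeland's principle, or a multiple of the length covered so far along a
  path.\<close>

lemma CauchyI:
  assumes le: "\<And>m n. n \<le> m \<Longrightarrow> p (x m - x n) \<le> \<bar>r m - r n\<bar>"
    and r: "Cauchy (r :: nat \<Rightarrow> real)"
  shows "Cauchy x"
proof (rule metric_CauchyI)
  obtain a where a: "0 < a" "\<And>v. norm v \<le> a * p v"
    by (rule lower_bound) blast
  fix e :: real assume "0 < e"
  then obtain N where N: "\<And>m n. m \<ge> N \<Longrightarrow> n \<ge> N \<Longrightarrow> dist (r m) (r n) < e / a"
    using metric_CauchyD [OF r, of "e / a"] a by auto
  have *: "dist (x m) (x n) < e" if "N \<le> n" "n \<le> m" for m n
  proof -
    have "dist (x m) (x n) \<le> a * p (x m - x n)"
      using a by (simp add: dist_norm)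
    also have "\<dots> \<le> a * \<bar>r m - r n\<bar>"
      using le [OF that(2)] a by (intro mult_left_mono) auto
    also have "\<dots> < a * (e / a)"
      using N [of m n] that a by (intro mult_strict_left_mono) (auto simp: dist_real_def)
    finally show ?thesis using a by simp
  qed
  have "dist (x m) (x n) < e" if "N \<le> n" "N \<le> m" for m n
    using *[of m n] *[of n m] that by (cases "n \<le> m") (auto simp: dist_commute)
  then show "\<exists>N. \<forall>m\<ge>N. \<forall>n\<ge>N. dist (x m) (x n) < e"
    by blast
qed

text \<open>One-sided difference quotients suffice: the triangle inequality bounds them by
  \<open>p v\<close>, and in the direction \<open>y0\<close> they equal \<open>p y0\<close> by
  homogeneity. For \<open>y0 \<noteq> 0\<close> the derivative is thus a norming functional, of dual
  norm 1 for \<open>p\<close>.\<close>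

lemma has_derivative_le:
  assumes "(p has_derivative y) (at y0)"
  shows "y v \<le> p v" "y y0 = p y0"
proof -
  have lim: "((\<lambda>t. (p (y0 + t *\<^sub>R v) - p y0) / t) \<longlongrightarrow> y v) (at_right 0)" for v
  proof -
    have "((\<lambda>t::real. y0 + t *\<^sub>R v) has_derivative (\<lambda>t. t *\<^sub>R v)) (at 0)"
      by (auto intro!: derivative_eq_intros)
    moreover have "(p has_derivative y) (at (y0 + 0 *\<^sub>R v))"
      using assms by simp
    ultimately have "((\<lambda>t. p (y0 + t *\<^sub>R v)) has_derivative (\<lambda>t. y (t *\<^sub>R v))) (at 0)"
      by (rule has_derivative_compose)
    moreover have "(\<lambda>t. y (t *\<^sub>R v)) = (*) (y v)"
      using has_derivative_bounded_linear [OF assms]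
      by (auto simp: linear_simps mult.commute)
    ultimately have "((\<lambda>t. p (y0 + t *\<^sub>R v)) has_field_derivative y v) (at 0)"
      by (simp add: has_field_derivative_def)
    then show ?thesis
      by (auto simp: has_field_derivative_iff intro: tendsto_within_subset)
  qed
  show "y v \<le> p v"
  proof (rule tendsto_upperbound [OF lim])
    show "\<forall>\<^sub>F t in at_right 0. (p (y0 + t *\<^sub>R v) - p y0) / t \<le> p v"
      using eventually_at_right_less [of 0]
    proof eventually_elim
      case (elim t)
      then have "p (y0 + t *\<^sub>R v) \<le> p y0 + t * p v"
        using triangle [of y0 "t *\<^sub>R v"] by simp
      then show ?case
        using elim by (simp add: field_simps)
    qed
  qed simp
  have "\<forall>\<^sub>F t in at_right 0. (p (y0 + t *\<^sub>R y0) - p y0) / t = p y0"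
    using eventually_at_right_less [of 0]
  proof eventually_elim
    case (elim t)
    then have "p (y0 + t *\<^sub>R y0) = (1 + t) * p y0"
      using scaleR [of "1 + t" y0] by (simp add: algebra_simps)
    then show ?case
      using elim by (simp add: field_simps)
  qed
  then have "((\<lambda>t. (p (y0 + t *\<^sub>R y0) - p y0) / t) \<longlongrightarrow> p y0) (at_right 0)"
    by (simp add: tendsto_eventually)
  with lim [of y0] show "y y0 = p y0"
    by (rule tendsto_unique [rotated]) simp
qed

text \<open>Bisection works because the inequality with slack \<open>e * (t - s)\<close> adds up
  over adjacent intervals and holds on all short intervals around a given point, where both
  functions are nearly affine. Later \<open>F\<close> is a path in coordinates and \<open>G\<close>
  a multiple of its arc length.\<close>

lemma mean_value_bound:
  assumes "a \<le> b"
    and F: "\<And>t. t \<in> {a..b} \<Longrightarrow> (F has_vector_derivative F' t) (at t within {a..b})"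
    and G: "\<And>t. t \<in> {a..b} \<Longrightarrow> (G has_real_derivative G' t) (at t within {a..b})"
    and le: "\<And>t. t \<in> {a..b} \<Longrightarrow> p (F' t) \<le> G' t"
  shows "p (F b - F a) \<le> G b - G a"
proof (rule field_le_epsilon)
  fix e' :: real assume "0 < e'"
  \<comment> \<open>The \<open>+ 1\<close> covers the degenerate interval
    \<open>a = b\<close>.\<close>
  define e where "e = e' / (b - a + 1)"
  have e: "0 < e" "e * (b - a) \<le> e'"
    using \<open>0 < e'\<close> \<open>a \<le> b\<close> by (auto simp: e_def field_simps)
  obtain B where B: "0 < B" "\<And>v. p v \<le> B * norm v"
    by (rule upper_bound) blast
  define P where "P s t \<longleftrightarrow> (a \<le> s \<and> s \<le> t \<and> t \<le> b \<longrightarrow> p (F t - F s) \<le> G t - G s + e * (t - s))" for s t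
  have "P a b"
  proof (rule Bolzano [OF \<open>a \<le> b\<close>])
    fix r s t assume "P r s" "P s t" "r \<le> s" "s \<le> t"
    then show "P r t"
      using triangle_diff [of "F t" "F r" "F s"] unfolding P_def by (auto simp: algebra_simps)
  next
    fix x assume "a \<le> x" "x \<le> b"
    then have x: "x \<in> {a..b}" by simp
    \<comment> \<open>Half of the slack goes to \<open>F\<close> and half to \<open>G\<close>; the
      factor \<open>B\<close> converts an error in the norm into one in \<open>p\<close>.\<close>
    have "\<exists>d>0. \<forall>t\<in>{a..b}. norm (t - x) < d \<longrightarrow>
        norm (F t - F x - (t - x) *\<^sub>R F' x) \<le> e / (2 * B) * norm (t - x)"
      using F [OF x] e B unfolding has_vector_derivative_def has_derivative_within_alt
      by (metis divide_pos_pos mult_pos_pos zero_less_numeral)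
    then obtain d1 where d1: "d1 > 0" "\<And>t. t\<in>{a..b} \<Longrightarrow> \<bar>t - x\<bar> < d1 \<Longrightarrow>
        norm (F t - F x - (t - x) *\<^sub>R F' x) \<le> e / (2 * B) * \<bar>t - x\<bar>"
      by auto
    have "\<exists>d>0. \<forall>t\<in>{a..b}. norm (t - x) < d \<longrightarrow>
        norm (G t - G x - G' x * (t - x)) \<le> e / 2 * norm (t - x)"
      using G [OF x] e unfolding has_field_derivative_def has_derivative_within_alt
      by (metis half_gt_zero)
    then obtain d2 where d2: "d2 > 0" "\<And>t. t\<in>{a..b} \<Longrightarrow> \<bar>t - x\<bar> < d2 \<Longrightarrow>
        \<bar>G t - G x - G' x * (t - x)\<bar> \<le> e / 2 * \<bar>t - x\<bar>"
      by auto
    have "P s t" if st: "s \<le> x" "x \<le> t" "t - s < min d1 d2" for s t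
      unfolding P_def
    proof safe
      assume ab: "a \<le> s" "s \<le> t" "t \<le> b"
      define rt where "rt = F t - F x - (t - x) *\<^sub>R F' x"
      define rs where "rs = F s - F x - (s - x) *\<^sub>R F' x"
      have rt: "p rt \<le> e / 2 * (t - x)"
      proof -
        have "p rt \<le> B * norm rt" by (rule B)
        also have "\<dots> \<le> B * (e / (2 * B) * (t - x))"
          using d1(2) [of t] st ab B by (intro mult_left_mono) (auto simp: rt_def)
        finally show ?thesis using B by simp
      qed
      have rs: "p rs \<le> e / 2 * (x - s)"
      proof -
        have "p rs \<le> B * norm rs" by (rule B)
        also have "\<dots> \<le> B * (e / (2 * B) * (x - s))"
          using d1(2) [of s] st ab B by (intro mult_left_mono) (auto simp: rs_def)
        finally show ?thesis using B by simp
      qed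
      have "F t - F s = (t - s) *\<^sub>R F' x + (rt - rs)"
        by (simp add: rt_def rs_def algebra_simps)
      then have "p (F t - F s) \<le> p ((t - s) *\<^sub>R F' x) + (p rt + p rs)"
        using triangle [of "(t - s) *\<^sub>R F' x" "rt - rs"] triangle [of rt "- rs"] by simp
      also have "p ((t - s) *\<^sub>R F' x) \<le> (t - s) * G' x"
        using le [OF x] st ab by (simp add: mult_left_mono)
      finally have "p (F t - F s) \<le> (t - s) * G' x + (p rt + p rs)"
        by simp
      also have "p rt + p rs \<le> e / 2 * (t - x) + e / 2 * (x - s)"
        using rt rs by (rule add_mono)
      also have "e / 2 * (t - x) + e / 2 * (x - s) = e / 2 * (t - s)"
        by (simp flip: distrib_left)
      finally have 1: "p (F t - F s) \<le> (t - s) * G' x + e / 2 * (t - s)"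
        by simp
      have "\<bar>G t - G x - G' x * (t - x)\<bar> \<le> e / 2 * (t - x)"
        "\<bar>G s - G x - G' x * (s - x)\<bar> \<le> e / 2 * (x - s)"
        using d2(2) [of t] d2(2) [of s] st ab by auto
      then have "G' x * (t - x) - G' x * (s - x) \<le> G t - G s + (e / 2 * (t - x) + e / 2 * (x - s))"
        unfolding abs_le_iff by linarith
      also have "e / 2 * (t - x) + e / 2 * (x - s) = e / 2 * (t - s)"
        by (simp flip: distrib_left)
      also have "G' x * (t - x) - G' x * (s - x) = (t - s) * G' x"
        by (simp add: algebra_simps)
      finally have "(t - s) * G' x \<le> G t - G s + e / 2 * (t - s)" .
      moreover have "e / 2 * (t - s) + e / 2 * (t - s) = e * (t - s)"
        by (simp flip: distrib_right)
      ultimately show "p (F t - F s) \<le> G t - G s + e * (t - s)"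
        using 1 by linarith
    qed
    then show "\<exists>d>0. \<forall>s t. s \<le> x \<and> x \<le> t \<and> t - s < d \<longrightarrow> P s t"
      using d1 d2 by (intro exI [of _ "min d1 d2"]) auto
  qed
  then show "p (F b - F a) \<le> G b - G a + e'"
    using e \<open>a \<le> b\<close> unfolding P_def by auto
qed

end

section \<open>Variational principle, minimax theorem and covering between Banach spaces\<close>

lemma renorming_scale:
  assumes "renorming p" "0 < k"
  shows "renorming (\<lambda>v. k * p v)"
proof -
  interpret renorming p by fact
  have "is_norm (\<lambda>v. k * p v)"
    unfolding is_norm_def
  proof (intro conjI allI)
    show "k * p (v + w) \<le> k * p v + k * p w" for v w
      using mult_left_mono [OF triangle [of v w], of k] \<open>0 < k\<close> by (simp add: distrib_left)
  qed (use \<open>0 < k\<close> in auto)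
  moreover obtain a b where ab: "0 < a" "0 < b" "\<And>v. a * norm v \<le> p v \<and> p v \<le> b * norm v"
    using equivalent unfolding equivalent_norm_def by blast
  have "equivalent_norm (\<lambda>v. k * p v)"
    unfolding equivalent_norm_def using \<open>0 < k\<close> ab
    by (intro exI [of _ "k * a"] exI [of _ "k * b"] conjI) (auto simp: mult.assoc)
  ultimately show ?thesis
    by unfold_locales
qed

text \<open>Let \<open>z'\<close> lie below \<open>z\<close> if the step from \<open>z\<close> to
  \<open>z'\<close> costs at most the drop of \<open>h\<close>. A minimal point below
  \<open>z1\<close> is found greedily: each choice at least halves the gap between \<open>h\<close>
  and its infimum over the points below the current one, and completeness gives a limit.\<close>

lemma ekeland_variational_principle:
  fixes p :: "'e::banach \<Rightarrow> real"
  assumes "renorming p"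
    and D: "closed D" "z1 \<in> D"
    and h: "continuous_on D h" "\<And>z. z \<in> D \<Longrightarrow> (0::real) \<le> h z"
  obtains z where "z \<in> D" "p (z - z1) \<le> h z1 - h z"
    "\<And>z'. z' \<in> D \<Longrightarrow> p (z' - z) \<le> h z - h z' \<Longrightarrow> z' = z"
proof -
  interpret renorming p by fact
  define S where "S z = {z' \<in> D. p (z' - z) \<le> h z - h z'}" for z
  have S_refl: "z \<in> S z" if "z \<in> D" for z
    using that by (simp add: S_def)
  have S_trans: "y \<in> S z" if "y \<in> S z'" "z' \<in> S z" for y z' z
    using that triangle_diff [of y z z'] by (auto simp: S_def)
  have "\<exists>z'\<in>S z. \<forall>y\<in>S z. h z' \<le> (h z + h y) / 2" if "z \<in> D" for z
  proof -
    have bdd: "bdd_below (h ` S z)"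
      by (rule bdd_belowI2 [of _ 0]) (use h in \<open>auto simp: S_def\<close>)
    have inf: "Inf (h ` S z) \<le> h y" if "y \<in> S z" for y
      using that bdd by (intro cInf_lower) auto
    show ?thesis
    \<comment> \<open>At the infimum no strictly better point exists, and \<open>z\<close> itself
      serves.\<close>
    proof (cases "h z = Inf (h ` S z)")
      case True
      then show ?thesis
        using S_refl [OF that] inf by (intro bexI [of _ z]) auto
    next
      case False
      then have "Inf (h ` S z) < h z"
        using inf [OF S_refl [OF that]] by simp
      then have "Inf (h ` S z) < (h z + Inf (h ` S z)) / 2"
        by simp
      then obtain z' where z': "z' \<in> S z" "h z' < (h z + Inf (h ` S z)) / 2"
        using cInf_lessD [of "h ` S z" "(h z + Inf (h ` S z)) / 2"] S_refl [OF \<open>z \<in> D\<close>] by blast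
      show ?thesis
      proof (intro bexI ballI)
        fix y assume "y \<in> S z"
        then show "h z' \<le> (h z + h y) / 2"
          using inf [of y] z' by simp
      qed fact
    qed
  qed
  then obtain nxt where nxt: "\<And>z. z \<in> D \<Longrightarrow> nxt z \<in> S z"
    "\<And>z y. z \<in> D \<Longrightarrow> y \<in> S z \<Longrightarrow> h (nxt z) \<le> (h z + h y) / 2"
    by metis
  define zs where "zs n = (nxt ^^ n) z1" for n
  have zs_Suc: "zs (Suc n) = nxt (zs n)" and zs_0: "zs 0 = z1" for n
    by (simp_all add: zs_def)
  have zs_D: "zs n \<in> D" for n
    by (induction n) (use D nxt in \<open>auto simp: zs_0 zs_Suc S_def\<close>)
  have zs_S: "zs m \<in> S (zs n)" if "n \<le> m" for m n
    using that
  proof (induction rule: dec_induct)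
    case base
    show ?case using S_refl zs_D .
  next
    case (step k)
    show ?case
      unfolding zs_Suc using S_trans [OF nxt(1) [OF zs_D] step.IH] .
  qed
  have zs_le: "p (zs m - zs n) \<le> h (zs n) - h (zs m)" if "n \<le> m" for m n
    using zs_S [OF that] by (simp add: S_def)
  have "decseq (\<lambda>n. h (zs n))"
  proof (rule decseq_SucI)
    fix n show "h (zs (Suc n)) \<le> h (zs n)"
      using zs_le [of n "Suc n"] nonneg [of "zs (Suc n) - zs n"] by linarith
  qed
  then have "convergent (\<lambda>n. h (zs n))"
    using decseq_convergent [of "\<lambda>n. h (zs n)" 0] zs_D h unfolding convergent_def by metis
  then have cau: "Cauchy (\<lambda>n. h (zs n))"
    by (rule convergent_Cauchy)
  have "Cauchy zs"
  proof (rule CauchyI [OF _ cau])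
    show "p (zs m - zs n) \<le> \<bar>h (zs m) - h (zs n)\<bar>" if "n \<le> m" for m n
      using zs_le [OF that] by linarith
  qed
  then obtain z where z: "zs \<longlonglongrightarrow> z"
    using Cauchy_convergent convergent_def by blast
  have zD: "z \<in> D"
    using closed_sequentially [OF D(1)] zs_D z by blast
  have hz: "(\<lambda>n. h (zs n)) \<longlonglongrightarrow> h z"
    using continuous_on_tendsto_compose [OF h(1) z zD] zs_D by auto
  have zS: "z \<in> S (zs n)" for n
  proof -
    have "(\<lambda>m. p (zs m - zs n)) \<longlonglongrightarrow> p (z - zs n)"
      "(\<lambda>m. h (zs n) - h (zs m)) \<longlonglongrightarrow> h (zs n) - h z"
      by (intro tendsto_intros z hz)+
    then have "p (z - zs n) \<le> h (zs n) - h z"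
      using LIMSEQ_le zs_le by blast
    then show ?thesis using zD by (simp add: S_def)
  qed
  show ?thesis
  proof (rule that [OF zD])
    show "p (z - z1) \<le> h z1 - h z"
      using zS [of 0] by (simp add: S_def zs_0)
    fix y assume "y \<in> D" "p (y - z) \<le> h z - h y"
    then have yS: "y \<in> S z" by (simp add: S_def)
    \<comment> \<open>A point \<open>y\<close> below the limit lies below every iterate, so it
      competes in every greedy choice; in the limit this forces
      \<open>h z \<le> h y\<close>.\<close>
    have "h (zs (Suc n)) \<le> (h (zs n) + h y) / 2" for n
      unfolding zs_Suc using nxt(2) [OF zs_D S_trans [OF yS zS]] .
    moreover have "(\<lambda>n. h (zs (Suc n))) \<longlonglongrightarrow> h z"
      using hz by (rule LIMSEQ_Suc)
    moreover have "(\<lambda>n. (h (zs n) + h y) / 2) \<longlonglongrightarrow> (h z + h y) / 2"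
      by (intro tendsto_intros hz) simp
    ultimately have "h z \<le> (h z + h y) / 2"
      using LIMSEQ_le by blast
    then have "p (y - z) \<le> 0"
      using \<open>p (y - z) \<le> h z - h y\<close> by simp
    then show "y = z"
      using nonneg [of "y - z"] by (metis antisym eq_zero eq_iff_diff_eq_0)
  qed
qed

text \<open>If the conclusion fails, the half-spaces \<open>H v\<close> in the proof have the finite intersection property
  in \<open>S\<close>: separation in the plane shows that cutting \<open>S\<close> by one \<open>H v\<close> preserves the hypotheses.\<close>

lemma minimax_compact_functionals:
  fixes S :: "('e::real_vector \<Rightarrow> real) set"
  assumes S: "compact S" "S \<noteq> {}" "\<And>s. s \<in> S \<Longrightarrow> linear s"
    and conv: "\<And>s t a. s \<in> S \<Longrightarrow> t \<in> S \<Longrightarrow> 0 \<le> a \<Longrightarrow> a \<le> 1 \<Longrightarrow> (\<lambda>v. (1 - a) * s v + a * t v) \<in> S"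
    and V: "convex V"
    and gt: "\<And>s. s \<in> S \<Longrightarrow> \<exists>v\<in>V. \<kappa> < s v"
  shows "\<exists>v\<in>V. \<forall>s\<in>S. \<kappa> \<le> s v"
proof (rule ccontr)
  assume neg: "\<not> ?thesis"
  define H where "H v = {s :: 'e \<Rightarrow> real. s v \<le> \<kappa>}" for v
  have cont: "continuous_on UNIV (\<lambda>s :: 'e \<Rightarrow> real. s v)" for v
    by simp
  have H: "closed (H v)" for v
    unfolding H_def by (intro closed_Collect_le cont continuous_on_const)
  define good where "good K \<longleftrightarrow> compact K \<and> K \<subseteq> S \<and>
    (\<forall>s\<in>K. \<forall>t\<in>K. \<forall>a\<in>{0..1}. (\<lambda>v. (1 - a) * s v + a * t v) \<in> K) \<and> (\<forall>v\<in>V. K \<inter> H v \<noteq> {})" for K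
  have "S \<inter> H v \<noteq> {}" if "v \<in> V" for v
    using neg that unfolding H_def by (auto simp: not_le intro: less_imp_le)
  then have good_S: "good S"
    using S conv by (auto simp: good_def)
  have good_step: "good (K \<inter> H v1)" if K: "good K" and v1: "v1 \<in> V" for K v1
  proof -
    have "compact (K \<inter> H v1)" "K \<inter> H v1 \<subseteq> S"
      using K H by (auto simp: good_def compact_Int_closed)
    moreover have "(\<lambda>v. (1 - a) * s v + a * t v) \<in> K \<inter> H v1"
      if "s \<in> K \<inter> H v1" "t \<in> K \<inter> H v1" "a \<in> {0..1}" for s t a
    proof -
      have "(1 - a) * s v1 + a * t v1 \<le> \<kappa>"
        using that convex_bound_le [of "s v1" \<kappa> "t v1" "1 - a" a] by (simp add: H_def)
      then show ?thesis
        using that K by (auto simp: good_def H_def)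
    qed
    moreover have "K \<inter> H v1 \<inter> H v2 \<noteq> {}" if v2: "v2 \<in> V" for v2
    proof
      assume empty: "K \<inter> H v1 \<inter> H v2 = {}"
      \<comment> \<open>In the plane of values at \<open>v1\<close> and \<open>v2\<close>, emptiness
        means that the convex compact set \<open>P\<close> misses the quadrant
        \<open>Q\<close>.\<close>
      define P where "P = (\<lambda>s. (s v1, s v2)) ` K"
      define Q where "Q = {..\<kappa>} \<times> {..\<kappa>}"
      have "compact P"
        unfolding P_def using K
        by (intro compact_continuous_image continuous_on_Pair continuous_on_subset [OF cont])
          (auto simp: good_def)
      have "convex P"
        unfolding convex_alt
      proof safe
        fix s t :: "real \<times> real" and a :: real
        assume "s \<in> P" "t \<in> P" and a: "0 \<le> a" "a \<le> 1"
        then obtain s' t' where st: "s' \<in> K" "t' \<in> K" "s = (s' v1, s' v2)" "t = (t' v1, t' v2)"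
          by (auto simp: P_def)
        have "(\<lambda>v. (1 - a) * s' v + a * t' v) \<in> K"
          using K st a by (auto simp: good_def)
        then show "(1 - a) *\<^sub>R s + a *\<^sub>R t \<in> P"
          unfolding P_def by (rule rev_image_eqI) (simp add: st)
      qed
      have "P \<noteq> {}"
        using K v1 by (auto simp: good_def P_def)
      have "closed Q" "convex Q" "Q \<inter> P = {}"
        using empty by (auto simp: Q_def P_def H_def closed_Times convex_Times)
      then obtain l b where lb: "\<forall>x\<in>Q. inner l x < b" "\<forall>x\<in>P. inner l x > b"
        using separating_hyperplane_closed_compact [OF \<open>convex Q\<close> \<open>closed Q\<close> \<open>convex P\<close> \<open>compact P\<close> \<open>P \<noteq> {}\<close>]
        by blast
      obtain l1 l2 where l: "l = (l1, l2)" by fastforce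
      have Q: "l1 * x1 + l2 * x2 < b" if "x1 \<le> \<kappa>" "x2 \<le> \<kappa>" for x1 x2
        using lb(1) that by (auto simp: Q_def l)
      have P: "l1 * s v1 + l2 * s v2 > b" if "s \<in> K" for s
        using lb(2) that by (auto simp: P_def l)
      \<comment> \<open>\<open>Q\<close> contains points with arbitrarily negative coordinates, so a
        functional bounded above on \<open>Q\<close> cannot have a negative coefficient.\<close>
      have "0 \<le> l1"
      proof (rule ccontr)
        assume "\<not> 0 \<le> l1"
        define x1 where "x1 = min \<kappa> ((b - l2 * \<kappa>) / l1)"
        have "x1 \<le> (b - l2 * \<kappa>) / l1" "x1 \<le> \<kappa>" by (auto simp: x1_def)
        then show False
          using Q [of x1 \<kappa>] \<open>\<not> 0 \<le> l1\<close> by (simp add: field_simps)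
      qed
      have "0 \<le> l2"
      proof (rule ccontr)
        assume "\<not> 0 \<le> l2"
        define x2 where "x2 = min \<kappa> ((b - l1 * \<kappa>) / l2)"
        have "x2 \<le> (b - l1 * \<kappa>) / l2" "x2 \<le> \<kappa>" by (auto simp: x2_def)
        then show False
          using Q [of \<kappa> x2] \<open>\<not> 0 \<le> l2\<close> by (simp add: field_simps)
      qed
      obtain s0 where "s0 \<in> K" using K v1 by (force simp: good_def)
      have "\<not> (l1 = 0 \<and> l2 = 0)"
        using Q [of \<kappa> \<kappa>] P [OF \<open>s0 \<in> K\<close>] by auto
      with \<open>0 \<le> l1\<close> \<open>0 \<le> l2\<close> have pos: "0 < l1 + l2" by auto
      \<comment> \<open>Normalizing the separating functional gives a point \<open>v\<close> of
        \<open>V\<close> at which every \<open>s\<close> in \<open>K\<close> exceeds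
        \<open>\<kappa>\<close>, against \<open>K \<inter> H v \<noteq> {}\<close>.\<close>
      define v where "v = (l1 / (l1 + l2)) *\<^sub>R v1 + (l2 / (l1 + l2)) *\<^sub>R v2"
      have "v \<in> V"
        unfolding v_def using V v1 v2 \<open>0 \<le> l1\<close> \<open>0 \<le> l2\<close> pos
        by (intro convexD) (auto simp flip: add_divide_distrib)
      then obtain s where s: "s \<in> K" "s v \<le> \<kappa>"
        using K unfolding good_def H_def by blast
      then have "linear s"
        using K S by (auto simp: good_def)
      then have "s v = (l1 * s v1 + l2 * s v2) / (l1 + l2)"
        by (simp add: v_def linear_add linear_scale add_divide_distrib)
      moreover have "b / (l1 + l2) < (l1 * s v1 + l2 * s v2) / (l1 + l2)"
        using P [OF s(1)] pos by (simp add: divide_strict_right_mono)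
      moreover have "\<kappa> < b / (l1 + l2)"
        using Q [of \<kappa> \<kappa>] pos by (simp add: field_simps)
      ultimately show False
        using s by simp
    qed
    ultimately show ?thesis
      by (auto simp: good_def)
  qed
  have good_fin: "good (S \<inter> (\<Inter>v\<in>F. H v))" if "finite F" "F \<subseteq> V" for F
    using that
  proof (induction rule: finite_induct)
    case empty
    then show ?case using good_S by simp
  next
    case (insert v F)
    then have "good (S \<inter> (\<Inter>v\<in>F. H v) \<inter> H v)"
      by (intro good_step) auto
    moreover have "S \<inter> (\<Inter>v\<in>F. H v) \<inter> H v = S \<inter> (\<Inter>v\<in>insert v F. H v)" by auto
    ultimately show ?case by simp
  qed
  obtain v0 where v0: "v0 \<in> V" using S gt by blast
  have "S \<inter> \<Inter>(H ` V) \<noteq> {}"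
  proof (rule compact_imp_fip [OF S(1)])
    fix F' assume "finite F'" "F' \<subseteq> H ` V"
    then obtain F where "finite F" "F \<subseteq> V" "F' = H ` F"
      by (meson finite_subset_image)
    then show "S \<inter> \<Inter>F' \<noteq> {}"
      using good_fin [of F] v0 by (auto simp: good_def)
  qed (use H in auto)
  then obtain s where "s \<in> S" "\<And>v. v \<in> V \<Longrightarrow> s v \<le> \<kappa>"
    by (auto simp: H_def)
  then show False
    using gt by force
qed

text \<open>The pseudo-Jacobian inequality gives a rate only for \<open>y\<close> composed with
  \<open>g\<close>. Differentiability of \<open>p\<close> at \<open>w - g z\<close> transfers it to
  \<open>p\<close>: the remainder is small relative to the increment of \<open>g\<close>, and
  \<open>calm\<close> makes this increment of order \<open>t\<close>.\<close>

lemma pseudo_jacobian_descent: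
  fixes g :: "'e::banach \<Rightarrow> 'f::banach"
  assumes "renorming p"
    and y: "(p has_derivative blinfun_apply y) (at (w - g z))"
    and calm: "\<forall>\<^sub>F z' in nhds z. norm (g z' - g z) \<le> K * norm (z' - z)"
    and J: "pseudo_jacobian g z J"
    and v: "\<And>T. T \<in> J \<Longrightarrow> \<kappa> \<le> blinfun_apply y (blinfun_apply T v)"
    and \<kappa>: "\<kappa>' < \<kappa>"
  shows "\<forall>\<^sub>F t in at_right 0. p (w - g (z + t *\<^sub>R v)) \<le> p (w - g z) - \<kappa>' * t"
proof -
  interpret renorming p by fact
  \<comment> \<open>The midpoint splits the gap: \<open>\<kappa> - \<kappa>2\<close> makes the bound
    on the limit superior strict, and \<open>\<kappa>2 - \<kappa>'\<close> absorbs the remainder of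
    the derivative of \<open>p\<close>.\<close>
  define \<kappa>2 where "\<kappa>2 = (\<kappa> + \<kappa>') / 2"
  have \<kappa>2: "\<kappa>' < \<kappa>2" "\<kappa>2 < \<kappa>"
    using \<kappa> by (auto simp: \<kappa>2_def)
  \<comment> \<open>\<open>L\<close> bounds the growth rate of \<open>g\<close> along
    \<open>v\<close>; the \<open>+ 1\<close> keeps it positive, so that \<open>e\<close> can be
    formed.\<close>
  define L where "L = \<bar>K\<bar> * norm v + 1"
  have L: "0 < L"
    unfolding L_def by (intro add_nonneg_pos mult_nonneg_nonneg) auto
  define e where "e = (\<kappa>2 - \<kappa>') / L"
  have e: "0 < e" using \<kappa>2 L by (simp add: e_def)
  have "Limsup (at_right 0) (\<lambda>t. ereal ((blinfun_apply (- y) (g (z + t *\<^sub>R v)) - blinfun_apply (- y) (g z)) / t))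
       \<le> (SUP T\<in>J. ereal (blinfun_apply (- y) (blinfun_apply T v)))"
    using J unfolding pseudo_jacobian_def by blast
  also have "\<dots> \<le> ereal (- \<kappa>)"
    by (rule SUP_least) (use v in \<open>auto simp: uminus_blinfun.rep_eq\<close>)
  also have "\<dots> < ereal (- \<kappa>2)"
    using \<kappa>2 by simp
  finally have ev1: "\<forall>\<^sub>F t in at_right 0. (blinfun_apply (- y) (g (z + t *\<^sub>R v)) - blinfun_apply (- y) (g z)) / t < - \<kappa>2"
    by (auto dest: Limsup_lessD)
  have tend: "((\<lambda>t. z + t *\<^sub>R v) \<longlongrightarrow> z) (at_right 0)"
    by (auto intro!: tendsto_eq_intros)
  have ev2: "\<forall>\<^sub>F t in at_right 0. norm (g (z + t *\<^sub>R v) - g z) \<le> K * norm (t *\<^sub>R v)"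
    using eventually_compose_filterlim [OF calm tend] by simp
  obtain d where d: "0 < d" "\<And>u. norm (u - (w - g z)) < d \<Longrightarrow>
      norm (p u - p (w - g z) - blinfun_apply y (u - (w - g z))) \<le> e * norm (u - (w - g z))"
    using y e unfolding has_derivative_at_alt by blast
  have "((\<lambda>t. L * t) \<longlongrightarrow> 0) (at_right 0)"
    by (auto intro!: tendsto_eq_intros)
  then have ev3: "\<forall>\<^sub>F t in at_right 0. L * t < d"
    using d by (auto dest: order_tendstoD(2))
  show ?thesis
    using ev1 ev2 ev3 eventually_at_right_less [of 0]
  proof eventually_elim
    case (elim t)
    define \<Delta> where "\<Delta> = g (z + t *\<^sub>R v) - g z"
    have "norm \<Delta> \<le> K * (norm v * t)"
      using elim by (simp add: \<Delta>_def mult.commute)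
    also have "\<dots> \<le> \<bar>K\<bar> * (norm v * t)"
      using elim by (intro mult_right_mono) auto
    also have "\<dots> \<le> L * t"
      using elim by (simp add: L_def algebra_simps)
    finally have \<Delta>: "norm \<Delta> \<le> L * t" .
    have eq: "w - g (z + t *\<^sub>R v) - (w - g z) = - \<Delta>"
      by (simp add: \<Delta>_def)
    have "p (w - g (z + t *\<^sub>R v)) - p (w - g z) - blinfun_apply y (- \<Delta>) \<le> e * norm \<Delta>"
      using d(2) [of "w - g (z + t *\<^sub>R v)"] \<Delta> elim unfolding eq by (simp add: blinfun.bilinear_simps)
    also have "\<dots> \<le> e * (L * t)"
      using \<Delta> e by (intro mult_left_mono) auto
    also have "\<dots> = (\<kappa>2 - \<kappa>') * t"
      using L by (simp add: e_def)
    finally have 1: "p (w - g (z + t *\<^sub>R v)) \<le> p (w - g z) + blinfun_apply y (- \<Delta>) + (\<kappa>2 - \<kappa>') * t"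
      by simp
    have "blinfun_apply y (- \<Delta>) < - \<kappa>2 * t"
      using elim by (simp add: \<Delta>_def blinfun.bilinear_simps field_simps)
    with 1 show ?case
      by (simp add: algebra_simps)
  qed
qed

text \<open>Ekeland's principle for \<open>\<lambda>z. p (w - g z)\<close> and the norm
  \<open>\<kappa>' * q\<close> yields a point that no move improves by as much as it costs. If it
  were not a solution, a short move along \<open>v\<close> would cost at most
  \<open>\<kappa>' * t\<close>, since \<open>q v \<le> 1\<close>, and gain at least that
  much.\<close>

lemma covering_of_regular_pseudo_jacobian:
  fixes g :: "'e::banach \<Rightarrow> 'f::banach"
  assumes q: "renorming q" and p: "renorming p" and smooth: "\<And>v. v \<noteq> 0 \<Longrightarrow> p differentiable (at v)"
    and calm: "\<And>z. q (z - z1) < s \<Longrightarrow> \<exists>K. \<forall>\<^sub>F z' in nhds z. norm (g z' - g z) \<le> K * norm (z' - z)"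
    and J: "\<And>z. q (z - z1) < s \<Longrightarrow> pseudo_jacobian g z (J z)"
    and reg: "\<And>z y y0. q (z - z1) < s \<Longrightarrow> y0 \<noteq> 0 \<Longrightarrow> (p has_derivative blinfun_apply y) (at y0) \<Longrightarrow>
       \<exists>v. v \<noteq> 0 \<and> q v \<le> 1 \<and> (\<forall>T\<in>J z. \<kappa> \<le> blinfun_apply y (blinfun_apply T v))"
    and \<kappa>: "0 < \<kappa>'" "\<kappa>' < \<kappa>"
    and w: "p (w - g z1) < \<kappa>' * s"
  obtains z where "\<kappa>' * q (z - z1) \<le> p (w - g z1)" "g z = w"
proof -
  interpret q: renorming q by fact
  interpret p: renorming p by fact
  \<comment> \<open>The strict bound on \<open>p (w - g z1)\<close> keeps this closed ball inside
    the open \<open>q\<close>-ball of radius \<open>s\<close>, where the local hypotheses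
    hold.\<close>
  define D where "D = {z. \<kappa>' * q (z - z1) \<le> p (w - g z1)}"
  have D: "q (z - z1) < s" if "z \<in> D" for z
  proof -
    have "\<kappa>' * q (z - z1) < \<kappa>' * s" using that w by (simp add: D_def)
    then show ?thesis using \<kappa> by simp
  qed
  have "isCont g z" if z: "z \<in> D" for z
  proof -
    obtain K where K: "\<forall>\<^sub>F z' in nhds z. norm (g z' - g z) \<le> K * norm (z' - z)"
      using calm [OF D [OF z]] by blast
    have "((\<lambda>z'. g z' - g z) \<longlongrightarrow> 0) (at z)"
    proof (rule Lim_null_comparison)
      show "\<forall>\<^sub>F z' in at z. norm (g z' - g z) \<le> K * norm (z' - z)"
        using K by (simp add: eventually_nhds_conv_at)
      show "((\<lambda>z'. K * norm (z' - z)) \<longlongrightarrow> 0) (at z)"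
        by (auto intro!: tendsto_eq_intros)
    qed
    then show ?thesis
      by (simp add: isCont_def LIM_zero_iff)
  qed
  then have cont: "continuous_on D (\<lambda>z. p (w - g z))"
    by (intro continuous_intros p.continuous_on_compose) (auto intro: continuous_at_imp_continuous_on)
  have closed: "closed D"
    unfolding D_def by (intro closed_Collect_le continuous_intros q.continuous_on_compose)
  have "z1 \<in> D" by (simp add: D_def)
  obtain z where z: "z \<in> D" "\<kappa>' * q (z - z1) \<le> p (w - g z1) - p (w - g z)"
    and min: "\<And>z'. z' \<in> D \<Longrightarrow> \<kappa>' * q (z' - z) \<le> p (w - g z) - p (w - g z') \<Longrightarrow> z' = z"
    using ekeland_variational_principle [OF renorming_scale [OF q \<kappa>(1)] closed \<open>z1 \<in> D\<close> cont] by auto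
  have "g z = w"
  proof (rule ccontr)
    assume "g z \<noteq> w"
    then have ne: "w - g z \<noteq> 0" by simp
    then obtain y' where y': "(p has_derivative y') (at (w - g z))"
      using smooth [OF ne] unfolding differentiable_def by blast
    define y where "y = Blinfun y'"
    have y: "(p has_derivative blinfun_apply y) (at (w - g z))"
      using y' has_derivative_bounded_linear [OF y'] by (simp add: y_def bounded_linear_Blinfun_apply)
    obtain v where v: "v \<noteq> 0" "q v \<le> 1" "\<And>T. T \<in> J z \<Longrightarrow> \<kappa> \<le> blinfun_apply y (blinfun_apply T v)"
      using reg [OF D [OF z(1)] ne y] by blast
    obtain K where K: "\<forall>\<^sub>F z' in nhds z. norm (g z' - g z) \<le> K * norm (z' - z)"
      using calm [OF D [OF z(1)]] by blast
    have "\<forall>\<^sub>F t in at_right 0. p (w - g (z + t *\<^sub>R v)) \<le> p (w - g z) - \<kappa>' * t"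
      by (rule pseudo_jacobian_descent [OF p y K J [OF D [OF z(1)]] v(3) \<kappa>(2)])
    then have "\<forall>\<^sub>F t in at_right 0. p (w - g (z + t *\<^sub>R v)) \<le> p (w - g z) - \<kappa>' * t \<and> 0 < t"
      using eventually_at_right_less [of 0] by eventually_elim simp
    then obtain t where t: "p (w - g (z + t *\<^sub>R v)) \<le> p (w - g z) - \<kappa>' * t" "0 < t"
      using eventually_happens' [of "at_right (0::real)"] by force
    define z' where "z' = z + t *\<^sub>R v"
    have "\<kappa>' * (t * q v) \<le> \<kappa>' * t"
      using v t \<kappa> by (intro mult_left_mono) (auto simp: mult_left_le)
    then have le: "\<kappa>' * q (z' - z) \<le> p (w - g z) - p (w - g z')"
      using t by (simp add: z'_def)
    \<comment> \<open>The cost of the move and the cost already paid are together covered by the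
      total drop, so \<open>z'\<close> is still an admissible competitor.\<close>
    have "\<kappa>' * q (z' - z1) \<le> \<kappa>' * q (z' - z) + \<kappa>' * q (z - z1)"
      using q.triangle_diff [of z' z1 z] \<kappa> by (simp flip: distrib_left)
    also have "\<dots> \<le> p (w - g z1)"
      using le z(2) p.nonneg [of "w - g z'"] by linarith
    finally have "z' \<in> D" by (simp add: D_def)
    from min [OF this le] show False
      using v t by (simp add: z'_def)
  qed
  with z(1) show ?thesis
    by (intro that [of z]) (auto simp: D_def)
qed


section \<open>Charts and paths\<close>

lemma chart_inv [simp]:
  assumes "is_chart c"
  shows "u \<in> dom_chart c \<Longrightarrow> inv_chart c (map_chart c u) = u"
    and "z \<in> img_chart c \<Longrightarrow> map_chart c (inv_chart c z) = z"
    and "z \<in> img_chart c \<Longrightarrow> inv_chart c z \<in> dom_chart c"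
    and "u \<in> dom_chart c \<Longrightarrow> map_chart c u \<in> img_chart c"
  using assms unfolding is_chart_def homeomorphism_def by auto

lemma chart_open: "is_chart c \<Longrightarrow> open (dom_chart c)" "is_chart c \<Longrightarrow> open (img_chart c)"
  and chart_continuous: "is_chart c \<Longrightarrow> continuous_on (dom_chart c) (map_chart c)"
    "is_chart c \<Longrightarrow> continuous_on (img_chart c) (inv_chart c)"
  unfolding is_chart_def homeomorphism_def by auto

lemma chart_image_open:
  assumes c: "is_chart c" and U: "open U" "U \<subseteq> dom_chart c"
  shows "open (map_chart c ` U)"
proof -
  have "map_chart c ` U = img_chart c \<inter> inv_chart c -` U"
    using c U by (auto simp: image_iff) (metis chart_inv(2))
  then show ?thesis
    using continuous_open_preimage [OF chart_continuous(2) [OF c] chart_open(2) [OF c] U(1)] by simp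
qed

lemma chart_preimage_open:
  assumes c: "is_chart c" and U: "open U"
  shows "open (dom_chart c \<inter> map_chart c -` U)"
  by (rule continuous_open_preimage [OF chart_continuous(1) [OF c] chart_open(1) [OF c] U])

section \<open>Tangent vectors and changes of charts\<close>

locale c1_manifold =
  fixes A :: "('x::t2_space, 'e::banach) chart set"
  assumes manifold: "C1_manifold A"
begin

lemma is_chart [simp]: "c \<in> A \<Longrightarrow> is_chart c"
  and C1_compatible: "c \<in> A \<Longrightarrow> c' \<in> A \<Longrightarrow> C1_compatible c c'"
  using manifold unfolding C1_manifold_def by blast+

lemma is_chart_at [simp]: "c \<in> charts_at A x \<Longrightarrow> is_chart c"
  unfolding charts_at_def by simp

lemma charts_at_nonempty: obtains c where "c \<in> charts_at A x"
  using manifold unfolding C1_manifold_def charts_at_def by blast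

text \<open>\<open>frechet_derivative\<close> is a choice without meaning where no derivative
  exists; C1 compatibility excludes this for changes of charts.\<close>

lemma transition_derivative:
  assumes "c \<in> charts_at A x" "c' \<in> charts_at A x"
  shows "(map_chart c' \<circ> inv_chart c has_derivative (\<lambda>v. dinv_chart A c x v c')) (at (map_chart c x))"
proof -
  have "C1_compatible c c'" "x \<in> dom_chart c \<inter> dom_chart c'"
    using assms C1_compatible by (auto simp: charts_at_def)
  then have "(map_chart c' \<circ> inv_chart c) differentiable (at (map_chart c x))"
    unfolding C1_compatible_def C1_on_def differentiable_def by blast
  then show ?thesis
    using assms by (simp add: dinv_chart_def frechet_derivative_works)
qed

lemma bounded_linear_dinv_chart:
  "c \<in> charts_at A x \<Longrightarrow> c' \<in> charts_at A x \<Longrightarrow> bounded_linear (\<lambda>v. dinv_chart A c x v c')"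
  using transition_derivative by (rule has_derivative_bounded_linear)

lemma dinv_chart_same [simp]:
  assumes c: "c \<in> charts_at A x"
  shows "dinv_chart A c x v c = v"
proof -
  have x: "map_chart c x \<in> img_chart c"
    using c by (simp add: charts_at_def)
  have "((\<lambda>z. z) has_derivative (\<lambda>v. dinv_chart A c x v c)) (at (map_chart c x))"
    by (rule has_derivative_transform_within_open [OF transition_derivative [OF c c] _ x])
      (use c in \<open>auto simp: chart_open\<close>)
  then have "(\<lambda>v. dinv_chart A c x v c) = (\<lambda>v. v)"
    by (rule has_derivative_unique) simp
  then show ?thesis by metis
qed

text \<open>Chain rule for the composed change of charts, which is valid on the overlap of the
  domains of \<open>c\<close> and \<open>c'\<close>. It makes a tangent vector independent of the
  chart in which its coordinates are given.\<close>

lemma dinv_chart_trans: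
  assumes c: "c \<in> charts_at A x" and c': "c' \<in> charts_at A x"
  shows "dinv_chart A c' x (dinv_chart A c x v c') = dinv_chart A c x v"
proof
  fix c''
  show "dinv_chart A c' x (dinv_chart A c x v c') c'' = dinv_chart A c x v c''"
  proof (cases "c'' \<in> charts_at A x")
    case True
    let ?U = "map_chart c ` (dom_chart c \<inter> dom_chart c')"
    have "open ?U"
      using c c' by (intro chart_image_open) (auto simp: chart_open)
    moreover have "map_chart c x \<in> ?U"
      using c c' by (auto simp: charts_at_def)
    moreover have "((map_chart c'' \<circ> inv_chart c') \<circ> (map_chart c' \<circ> inv_chart c)) z =
        (map_chart c'' \<circ> inv_chart c) z" if "z \<in> ?U" for z
      using that c c' by auto
    moreover have "((map_chart c'' \<circ> inv_chart c') \<circ> (map_chart c' \<circ> inv_chart c) has_derivative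
        (\<lambda>v. dinv_chart A c' x v c'') \<circ> (\<lambda>v. dinv_chart A c x v c')) (at (map_chart c x))"
    proof (rule diff_chain_at [OF transition_derivative [OF c c']])
      have "(map_chart c' \<circ> inv_chart c) (map_chart c x) = map_chart c' x"
        using c by (simp add: charts_at_def)
      then show "(map_chart c'' \<circ> inv_chart c' has_derivative (\<lambda>v. dinv_chart A c' x v c''))
          (at ((map_chart c' \<circ> inv_chart c) (map_chart c x)))"
        using transition_derivative [OF c' True] by simp
    qed
    ultimately have "(map_chart c'' \<circ> inv_chart c has_derivative
        (\<lambda>v. dinv_chart A c' x v c'') \<circ> (\<lambda>v. dinv_chart A c x v c')) (at (map_chart c x))"
      by (rule has_derivative_transform_within_open [rotated])
    then have "(\<lambda>v. dinv_chart A c' x v c'') \<circ> (\<lambda>v. dinv_chart A c x v c') = (\<lambda>v. dinv_chart A c x v c'')"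
      using transition_derivative [OF c True] by (rule has_derivative_unique)
    then show ?thesis
      by (metis comp_apply)
  qed (simp add: dinv_chart_def)
qed

lemma tangent_space_eq:
  assumes c: "c \<in> charts_at A x"
  shows "tangent_space A x = range (dinv_chart A c x)"
  unfolding tangent_space_def
proof (intro antisym subsetI)
  fix \<xi> assume "\<xi> \<in> (\<Union>c\<in>charts_at A x. range (dinv_chart A c x))"
  then obtain c' v where "c' \<in> charts_at A x" "\<xi> = dinv_chart A c' x v"
    by blast
  then show "\<xi> \<in> range (dinv_chart A c x)"
    using dinv_chart_trans [OF _ c] by (metis rangeI)
qed (use c in blast)

section \<open>C1 paths: construction, velocity, reparametrization and joining\<close>

lemma C1_path_in_chart:
  assumes c: "c \<in> A" and ab: "a < b"
    and \<eta>: "\<And>t. t \<in> {a..b} \<Longrightarrow> (\<eta> has_vector_derivative \<eta>' t) (at t within {a..b})"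
    and \<eta>': "continuous_on {a..b} \<eta>'"
    and img: "\<eta> ` {a..b} \<subseteq> img_chart c"
  shows "C1_path A a b (\<lambda>t. inv_chart c (\<eta> t))"
  unfolding C1_path_def
proof (intro conjI ballI ab)
  have cont: "continuous_on {a..b} \<eta>"
    using \<eta> by (meson continuous_on_eq_continuous_within has_vector_derivative_continuous)
  then show "continuous_on {a..b} (\<lambda>t. inv_chart c (\<eta> t))"
    using continuous_on_compose2 [OF chart_continuous(2) _ img] c by auto
  fix c' assume c': "c' \<in> A"
  obtain g' :: "'e \<Rightarrow> 'e \<Rightarrow>\<^sub>L 'e"
    where g': "\<And>z. z \<in> map_chart c ` (dom_chart c \<inter> dom_chart c') \<Longrightarrow>
        (map_chart c' \<circ> inv_chart c has_derivative blinfun_apply (g' z)) (at z)"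
      "continuous_on (map_chart c ` (dom_chart c \<inter> dom_chart c')) g'"
    using C1_compatible [OF c c'] unfolding C1_compatible_def C1_on_def by blast
  let ?S = "{t \<in> {a..b}. inv_chart c (\<eta> t) \<in> dom_chart c'}"
  have S: "\<eta> t \<in> map_chart c ` (dom_chart c \<inter> dom_chart c')" if "t \<in> ?S" for t
  proof -
    have "\<eta> t \<in> img_chart c" using that img by blast
    then show ?thesis
      using that c by (intro image_eqI [of _ _ "inv_chart c (\<eta> t)"]) auto
  qed
  show "\<exists>D. continuous_on ?S D \<and> (\<forall>t\<in>{a..b}. inv_chart c (\<eta> t) \<in> dom_chart c' \<longrightarrow>
      (map_chart c' \<circ> (\<lambda>t. inv_chart c (\<eta> t)) has_vector_derivative D t) (at t within {a..b}))"
  proof (intro exI conjI ballI impI)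
    show "continuous_on ?S (\<lambda>t. blinfun_apply (g' (\<eta> t)) (\<eta>' t))"
      by (intro blinfun.continuous_on continuous_on_compose2 [OF g'(2)]
          continuous_on_subset [OF cont] continuous_on_subset [OF \<eta>']) (use S in auto)
    fix t assume t: "t \<in> {a..b}" "inv_chart c (\<eta> t) \<in> dom_chart c'"
    have "((map_chart c' \<circ> inv_chart c) \<circ> \<eta> has_vector_derivative blinfun_apply (g' (\<eta> t)) (\<eta>' t))
        (at t within {a..b})"
      by (rule vector_derivative_diff_chain_within [OF \<eta> has_derivative_at_withinI [OF g'(1)]])
        (use S t in auto)
    then show "(map_chart c' \<circ> (\<lambda>t. inv_chart c (\<eta> t)) has_vector_derivative
        blinfun_apply (g' (\<eta> t)) (\<eta>' t)) (at t within {a..b})"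
      by (simp add: comp_def)
  qed
qed

lemma eventually_in_chart:
  assumes "C1_path A a b \<sigma>" "t \<in> {a..b}" "c \<in> charts_at A (\<sigma> t)"
  shows "\<forall>\<^sub>F s in at t within {a..b}. \<sigma> s \<in> dom_chart c"
proof -
  have "(\<sigma> \<longlongrightarrow> \<sigma> t) (at t within {a..b})"
    using assms by (auto simp: C1_path_def continuous_on_def)
  then show ?thesis
    using topological_tendstoD [of \<sigma> "\<sigma> t" _ "dom_chart c"] assms
    by (auto simp: charts_at_def chart_open)
qed

text \<open>\<open>velocity\<close> refers to all charts at once; by the chain rule its coordinates
  in a single chart determine it. The change of charts may be inserted because the path stays in the
  domain of \<open>c\<close> for nearby times.\<close>

lemma velocity_eq:
  assumes \<sigma>: "C1_path A a b \<sigma>" and t: "t \<in> {a..b}" and c: "c \<in> charts_at A (\<sigma> t)"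
    and D: "(map_chart c \<circ> \<sigma> has_vector_derivative D) (at t within {a..b})"
  shows "velocity A a b \<sigma> t = dinv_chart A c (\<sigma> t) D"
proof
  fix c'
  show "velocity A a b \<sigma> t c' = dinv_chart A c (\<sigma> t) D c'"
  proof (cases "c' \<in> charts_at A (\<sigma> t)")
    case True
    have 1: "((map_chart c' \<circ> inv_chart c) \<circ> (map_chart c \<circ> \<sigma>) has_vector_derivative
        dinv_chart A c (\<sigma> t) D c') (at t within {a..b})"
    proof (rule vector_derivative_diff_chain_within [OF D has_derivative_at_withinI])
      show "(map_chart c' \<circ> inv_chart c has_derivative (\<lambda>v. dinv_chart A c (\<sigma> t) v c'))
          (at ((map_chart c \<circ> \<sigma>) t))"
        using transition_derivative [OF c True] by (simp only: comp_apply)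
    qed
    have "\<forall>\<^sub>F s in at t within {a..b}.
        ((map_chart c' \<circ> inv_chart c) \<circ> (map_chart c \<circ> \<sigma>)) s = (map_chart c' \<circ> \<sigma>) s"
      using eventually_in_chart [OF \<sigma> t c] by eventually_elim (use c in simp)
    then have "(map_chart c' \<circ> \<sigma> has_vector_derivative dinv_chart A c (\<sigma> t) D c') (at t within {a..b})"
      using 1 t c unfolding has_vector_derivative_def
      by (elim has_derivative_transform_eventually) (auto simp: charts_at_def)
    then have "vector_derivative (map_chart c' \<circ> \<sigma>) (at t within {a..b}) = dinv_chart A c (\<sigma> t) D c'"
      using vector_derivative_within_cbox [of a b t] \<sigma> t by (simp add: C1_path_def)
    then show ?thesis
      using True by (simp add: velocity_def)
  qed (simp add: velocity_def dinv_chart_def)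
qed

text \<open>The second conclusion is the reason for reparametrizing: where \<open>\<theta>'\<close>
  vanishes the new path is at rest in every chart, whatever the velocity of the old one.\<close>

lemma C1_path_reparam:
  assumes \<sigma>: "C1_path A a b \<sigma>" and "a' < b'"
    and \<theta>: "\<And>t. t \<in> {a'..b'} \<Longrightarrow> (\<theta> has_real_derivative \<theta>' t) (at t within {a'..b'})"
    and \<theta>': "continuous_on {a'..b'} \<theta>'" and sub: "\<theta> ` {a'..b'} \<subseteq> {a..b}"
  shows "C1_path A a' b' (\<sigma> \<circ> \<theta>)"
    and "\<And>t c. t \<in> {a'..b'} \<Longrightarrow> \<theta>' t = 0 \<Longrightarrow> c \<in> charts_at A (\<sigma> (\<theta> t)) \<Longrightarrow>
      (map_chart c \<circ> (\<sigma> \<circ> \<theta>) has_vector_derivative 0) (at t within {a'..b'})"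
proof -
  have cont: "continuous_on {a'..b'} \<theta>"
    using \<theta> by (meson DERIV_continuous continuous_on_eq_continuous_within)
  have deriv: "(map_chart c \<circ> (\<sigma> \<circ> \<theta>) has_vector_derivative \<theta>' t *\<^sub>R D) (at t within {a'..b'})"
    if "t \<in> {a'..b'}" "(map_chart c \<circ> \<sigma> has_vector_derivative D) (at (\<theta> t) within {a..b})" for t c D
  proof -
    have "((map_chart c \<circ> \<sigma>) \<circ> \<theta> has_vector_derivative \<theta>' t *\<^sub>R D) (at t within {a'..b'})"
      using \<theta> [OF that(1)] that(2) sub
      by (intro vector_diff_chain_within)
        (auto simp: has_real_derivative_iff_has_vector_derivative intro: has_vector_derivative_within_subset)
    then show ?thesis by (simp add: comp_assoc)
  qed
  show "C1_path A a' b' (\<sigma> \<circ> \<theta>)"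
    unfolding C1_path_def
  proof (intro conjI ballI)
    show "continuous_on {a'..b'} (\<sigma> \<circ> \<theta>)"
      using \<sigma> sub by (intro continuous_on_compose cont) (auto simp: C1_path_def intro: continuous_on_subset)
    fix c assume "c \<in> A"
    then obtain D where D: "continuous_on {t \<in> {a..b}. \<sigma> t \<in> dom_chart c} D"
      "\<And>t. t \<in> {a..b} \<Longrightarrow> \<sigma> t \<in> dom_chart c \<Longrightarrow>
        (map_chart c \<circ> \<sigma> has_vector_derivative D t) (at t within {a..b})"
      using \<sigma> unfolding C1_path_def by blast
    show "\<exists>D. continuous_on {t \<in> {a'..b'}. (\<sigma> \<circ> \<theta>) t \<in> dom_chart c} D \<and>
       (\<forall>t\<in>{a'..b'}. (\<sigma> \<circ> \<theta>) t \<in> dom_chart c \<longrightarrow>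
          (map_chart c \<circ> (\<sigma> \<circ> \<theta>) has_vector_derivative D t) (at t within {a'..b'}))"
    proof (intro exI conjI ballI impI)
      show "continuous_on {t \<in> {a'..b'}. (\<sigma> \<circ> \<theta>) t \<in> dom_chart c} (\<lambda>t. \<theta>' t *\<^sub>R D (\<theta> t))"
        by (intro continuous_on_scaleR continuous_on_compose2 [OF D(1)]
            continuous_on_subset [OF cont] continuous_on_subset [OF \<theta>']) (use sub in \<open>auto simp: image_subset_iff\<close>)
      fix t assume "t \<in> {a'..b'}" "(\<sigma> \<circ> \<theta>) t \<in> dom_chart c"
      then show "(map_chart c \<circ> (\<sigma> \<circ> \<theta>) has_vector_derivative \<theta>' t *\<^sub>R D (\<theta> t)) (at t within {a'..b'})"
        using sub by (intro deriv D(2)) (auto simp: image_subset_iff)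
    qed
  qed fact
  fix t c assume t: "t \<in> {a'..b'}" "\<theta>' t = 0" "c \<in> charts_at A (\<sigma> (\<theta> t))"
  then obtain D where "(map_chart c \<circ> \<sigma> has_vector_derivative D) (at (\<theta> t) within {a..b})"
    using \<sigma> sub unfolding C1_path_def charts_at_def by blast
  then show "(map_chart c \<circ> (\<sigma> \<circ> \<theta>) has_vector_derivative 0) (at t within {a'..b'})"
    using deriv [OF t(1)] t(2) by fastforce
qed

text \<open>With velocity zero on both sides of \<open>m\<close> the one-sided derivatives agree
  there in every chart, and the derivative is continuous across \<open>m\<close>; in general a
  concatenation is only piecewise C1.\<close>

lemma C1_path_join:
  assumes 1: "C1_path A a m \<sigma>" and 2: "C1_path A m b \<sigma>"
    and zero: "\<And>c. c \<in> charts_at A (\<sigma> m) \<Longrightarrow> (map_chart c \<circ> \<sigma> has_vector_derivative 0) (at m within {a..m})"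
      "\<And>c. c \<in> charts_at A (\<sigma> m) \<Longrightarrow> (map_chart c \<circ> \<sigma> has_vector_derivative 0) (at m within {m..b})"
  shows "C1_path A a b \<sigma>"
  unfolding C1_path_def
proof (intro conjI ballI)
  have am: "a < m" and mb: "m < b"
    using 1 2 by (auto simp: C1_path_def)
  then show "a < b" by simp
  have Un: "{a..b} = {a..m} \<union> {m..b}" using am mb by auto
  show "continuous_on {a..b} \<sigma>"
    unfolding Un using 1 2 by (intro continuous_on_closed_Un) (auto simp: C1_path_def)
  fix c assume "c \<in> A"
  obtain D1 where D1: "continuous_on {t \<in> {a..m}. \<sigma> t \<in> dom_chart c} D1"
    "\<And>t. t \<in> {a..m} \<Longrightarrow> \<sigma> t \<in> dom_chart c \<Longrightarrow>
        (map_chart c \<circ> \<sigma> has_vector_derivative D1 t) (at t within {a..m})"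
    using 1 \<open>c \<in> A\<close> unfolding C1_path_def by blast
  obtain D2 where D2: "continuous_on {t \<in> {m..b}. \<sigma> t \<in> dom_chart c} D2"
    "\<And>t. t \<in> {m..b} \<Longrightarrow> \<sigma> t \<in> dom_chart c \<Longrightarrow>
        (map_chart c \<circ> \<sigma> has_vector_derivative D2 t) (at t within {m..b})"
    using 2 \<open>c \<in> A\<close> unfolding C1_path_def by blast
  have D_m: "D1 m = 0" "D2 m = 0" if m: "\<sigma> m \<in> dom_chart c"
  proof -
    have c: "c \<in> charts_at A (\<sigma> m)"
      using m \<open>c \<in> A\<close> by (simp add: charts_at_def)
    have "m \<in> {a..m}" "m \<in> {m..b}" using am mb by auto
    then show "D1 m = 0" "D2 m = 0"
      using vector_derivative_within_cbox [unfolded box_real, OF am \<open>m \<in> {a..m}\<close> D1(2) [OF \<open>m \<in> {a..m}\<close> m]]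
        vector_derivative_within_cbox [unfolded box_real, OF am \<open>m \<in> {a..m}\<close> zero(1) [OF c]]
        vector_derivative_within_cbox [unfolded box_real, OF mb \<open>m \<in> {m..b}\<close> D2(2) [OF \<open>m \<in> {m..b}\<close> m]]
        vector_derivative_within_cbox [unfolded box_real, OF mb \<open>m \<in> {m..b}\<close> zero(2) [OF c]]
      by simp_all
  qed
  define D where "D t = (if t \<le> m then D1 t else D2 t)" for t
  have D: "(map_chart c \<circ> \<sigma> has_vector_derivative D t) (at t within {a..b})"
    if t: "t \<in> {a..b}" "\<sigma> t \<in> dom_chart c" for t
  proof (cases t m rule: linorder_cases)
    case less
    have "at t within {a..b} = at t within {a..m}"
      by (rule at_within_nhd [of _ "{..<m}"]) (use less mb in auto)
    then show ?thesis using D1(2) [of t] t less by (simp add: D_def)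
  next
    case greater
    have "at t within {a..b} = at t within {m..b}"
      by (rule at_within_nhd [of _ "{m<..}"]) (use greater am in auto)
    then show ?thesis using D2(2) [of t] t greater by (simp add: D_def)
  next
    case equal
    have "c \<in> charts_at A (\<sigma> m)" using t equal \<open>c \<in> A\<close> by (simp add: charts_at_def)
    \<comment> \<open>A vanishing derivative is a limit of difference quotients without a linear
      term, so the limits within the two halves combine into one within the union.\<close>
    have iff: "(map_chart c \<circ> \<sigma> has_vector_derivative 0) (at m within S) \<longleftrightarrow>
      ((\<lambda>y. (1 / \<bar>y - m\<bar>) *\<^sub>R (map_chart c (\<sigma> y) - map_chart c (\<sigma> m))) \<longlongrightarrow> 0) (at m within S)" for S
      by (simp add: has_vector_derivative_def has_derivative_within)
    have "(map_chart c \<circ> \<sigma> has_vector_derivative 0) (at m within {a..b})"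
      using zero [OF \<open>c \<in> charts_at A (\<sigma> m)\<close>]
      unfolding Un iff unfolding at_within_union by (rule filterlim_sup)
    then show ?thesis using equal D_m t by (simp add: D_def)
  qed
  have "continuous_on {t \<in> {a..b}. \<sigma> t \<in> dom_chart c} D"
    unfolding D_def
    by (rule continuous_on_cases_le)
      (use D_m am mb in \<open>auto intro: continuous_on_subset [OF D1(1)] continuous_on_subset [OF D2(1)]\<close>)
  with D show "\<exists>D. continuous_on {t \<in> {a..b}. \<sigma> t \<in> dom_chart c} D \<and>
     (\<forall>t\<in>{a..b}. \<sigma> t \<in> dom_chart c \<longrightarrow>
        (map_chart c \<circ> \<sigma> has_vector_derivative D t) (at t within {a..b}))"
    by blast
qed

lemma C1_path_cong:
  assumes \<sigma>: "C1_path A a b \<sigma>" and eq: "\<And>t. t \<in> {a..b} \<Longrightarrow> \<sigma> t = \<tau> t"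
  shows "C1_path A a b \<tau>"
  unfolding C1_path_def
proof (intro conjI ballI)
  show "a < b" "continuous_on {a..b} \<tau>"
    using \<sigma> continuous_on_cong [of "{a..b}" "{a..b}" \<sigma> \<tau>] eq by (auto simp: C1_path_def)
  fix c assume "c \<in> A"
  then obtain D where D: "continuous_on {t \<in> {a..b}. \<sigma> t \<in> dom_chart c} D"
    "\<And>t. t \<in> {a..b} \<Longrightarrow> \<sigma> t \<in> dom_chart c \<Longrightarrow>
        (map_chart c \<circ> \<sigma> has_vector_derivative D t) (at t within {a..b})"
    using \<sigma> unfolding C1_path_def by blast
  have "{t \<in> {a..b}. \<sigma> t \<in> dom_chart c} = {t \<in> {a..b}. \<tau> t \<in> dom_chart c}"
    using eq by auto
  moreover have "(map_chart c \<circ> \<tau> has_vector_derivative D t) (at t within {a..b})"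
    if "t \<in> {a..b}" "\<tau> t \<in> dom_chart c" for t
    by (rule has_vector_derivative_transform [OF _ _ D(2)]) (use that eq in auto)
  ultimately show "\<exists>D. continuous_on {t \<in> {a..b}. \<tau> t \<in> dom_chart c} D \<and>
     (\<forall>t\<in>{a..b}. \<tau> t \<in> dom_chart c \<longrightarrow>
        (map_chart c \<circ> \<tau> has_vector_derivative D t) (at t within {a..b}))"
    using D(1) by auto
qed

section \<open>Connectedness by C1 paths\<close>

definition joinable :: "'x \<Rightarrow> 'x \<Rightarrow> bool"
  where "joinable u v \<longleftrightarrow> (\<exists>a b \<sigma>. C1_path A a b \<sigma> \<and> \<sigma> a = u \<and> \<sigma> b = v)"

lemma joinable_refl: "joinable u u"
proof -
  obtain c where c: "c \<in> charts_at A u" by (rule charts_at_nonempty)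
  have "C1_path A 0 1 (\<lambda>t. inv_chart c (map_chart c u))"
    by (rule C1_path_in_chart [where \<eta>' = "\<lambda>_. 0"]) (use c in \<open>auto simp: charts_at_def\<close>)
  then show ?thesis
    unfolding joinable_def using c by (intro exI conjI) (auto simp: charts_at_def)
qed

text \<open>Both pieces are reparametrized quadratically, to make the velocity vanish at the junction.\<close>

lemma joinable_extend:
  assumes uv: "joinable u v" and c: "c \<in> A" "v \<in> dom_chart c" "v' \<in> dom_chart c"
    and seg: "closed_segment (map_chart c v) (map_chart c v') \<subseteq> img_chart c"
  shows "joinable u v'"
proof -
  obtain a b \<sigma> where \<sigma>: "C1_path A a b \<sigma>" "\<sigma> a = u" "\<sigma> b = v"
    using uv unfolding joinable_def by blast
  define \<theta> where "\<theta> t = b - (b - a) * (1 - t)\<^sup>2" for t :: real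
  have "a < b" using \<sigma> by (simp add: C1_path_def)
  have \<theta>: "(\<theta> has_real_derivative 2 * (b - a) * (1 - t)) (at t within {0..1})" for t
    unfolding \<theta>_def by (auto intro!: derivative_eq_intros simp: algebra_simps)
  have sub: "\<theta> ` {0..1} \<subseteq> {a..b}"
  proof safe
    fix t :: real assume "t \<in> {0..1}"
    then have "0 \<le> (1 - t)\<^sup>2" "(1 - t)\<^sup>2 \<le> 1" by (auto simp: abs_square_le_1)
    then have "0 \<le> (b - a) * (1 - t)\<^sup>2" "(b - a) * (1 - t)\<^sup>2 \<le> b - a"
      using \<open>a < b\<close> by (auto intro: mult_left_le)
    then show "\<theta> t \<in> {a..b}" by (simp add: \<theta>_def)
  qed
  have \<theta>1: "\<theta> 1 = b" by (simp add: \<theta>_def)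
  have cont: "continuous_on {0..1} (\<lambda>t. 2 * (b - a) * (1 - t))"
    by (intro continuous_intros)
  note reparam = C1_path_reparam [OF \<sigma>(1) zero_less_one \<theta> cont sub]
  have P1: "C1_path A 0 1 (\<sigma> \<circ> \<theta>)"
    "\<And>c. c \<in> charts_at A v \<Longrightarrow> (map_chart c \<circ> (\<sigma> \<circ> \<theta>) has_vector_derivative 0) (at 1 within {0..1})"
    using reparam(1) reparam(2) [of 1] \<sigma>(3) by (auto simp: \<theta>1)
  define z z' where "z = map_chart c v" and "z' = map_chart c v'"
  define \<beta> where "\<beta> t = inv_chart c (z + t *\<^sub>R (z' - z))" for t
  have "C1_path A 0 1 \<beta>"
    unfolding \<beta>_def
  proof (rule C1_path_in_chart [where \<eta>' = "\<lambda>_. z' - z"])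
    show "(\<lambda>t. z + t *\<^sub>R (z' - z)) ` {0..1} \<subseteq> img_chart c"
    proof safe
      fix t :: real assume "t \<in> {0..1}"
      then have "z + t *\<^sub>R (z' - z) \<in> closed_segment z z'"
        by (auto simp: in_segment algebra_simps intro!: exI [of _ t])
      then show "z + t *\<^sub>R (z' - z) \<in> img_chart c"
        using seg unfolding z_def z'_def by blast
    qed
  qed (auto intro!: derivative_eq_intros c)
  have \<theta>2: "((\<lambda>t. (t - 1)\<^sup>2) has_real_derivative 2 * (t - 1)) (at t within {1..2})" for t :: real
    by (auto intro!: derivative_eq_intros)
  have cont2: "continuous_on {1..2} (\<lambda>t. 2 * (t - 1 :: real))"
    by (intro continuous_intros)
  have sub2: "(\<lambda>t. (t - 1)\<^sup>2) ` {1..2} \<subseteq> {0..1 :: real}"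
    by (auto simp: power_le_one)
  note reparam2 = C1_path_reparam [OF \<open>C1_path A 0 1 \<beta>\<close> _ \<theta>2 cont2 sub2]
  have P2: "C1_path A 1 2 (\<beta> \<circ> (\<lambda>t. (t - 1)\<^sup>2))"
    "\<And>c. c \<in> charts_at A (\<beta> 0) \<Longrightarrow> (map_chart c \<circ> (\<beta> \<circ> (\<lambda>t. (t - 1)\<^sup>2)) has_vector_derivative 0) (at 1 within {1..2})"
    using reparam2(1) reparam2(2) [of 1] by auto
  have \<beta>: "\<beta> 0 = v" "\<beta> 1 = v'"
    using c by (auto simp: \<beta>_def z_def z'_def)
  define \<tau> where "\<tau> t = (if t \<le> 1 then (\<sigma> \<circ> \<theta>) t else (\<beta> \<circ> (\<lambda>t. (t - 1)\<^sup>2)) t)" for t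
  have \<tau>1: "\<tau> t = (\<sigma> \<circ> \<theta>) t" if "t \<in> {0..1}" for t
    using that by (simp add: \<tau>_def)
  have \<tau>2: "\<tau> t = (\<beta> \<circ> (\<lambda>t. (t - 1)\<^sup>2)) t" if "t \<in> {1..2}" for t
    using that \<beta> \<sigma> by (auto simp: \<tau>_def \<theta>_def)
  have "\<tau> 1 = v" using \<sigma> by (simp add: \<tau>_def \<theta>_def)
  have "C1_path A 0 2 \<tau>"
  proof (rule C1_path_join [of 0 1])
    show "C1_path A 0 1 \<tau>"
      by (rule C1_path_cong [OF P1(1)]) (simp add: \<tau>1)
    show "C1_path A 1 2 \<tau>"
      by (rule C1_path_cong [OF P2(1)]) (simp add: \<tau>2)
    fix c assume c: "c \<in> charts_at A (\<tau> 1)"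
    show "(map_chart c \<circ> \<tau> has_vector_derivative 0) (at 1 within {0..1})"
      by (rule has_vector_derivative_transform [OF _ _ P1(2)])
        (use c \<open>\<tau> 1 = v\<close> in \<open>auto simp: \<tau>1\<close>)
    show "(map_chart c \<circ> \<tau> has_vector_derivative 0) (at 1 within {1..2})"
      by (rule has_vector_derivative_transform [OF _ _ P2(2)])
        (use c \<open>\<tau> 1 = v\<close> \<beta> in \<open>auto simp: \<tau>2\<close>)
  qed
  moreover have "\<tau> 0 = u" "\<tau> 2 = v'"
    using \<sigma> \<beta> by (auto simp: \<tau>_def \<theta>_def)
  ultimately show ?thesis
    unfolding joinable_def by blast
qed

text \<open>The set of points joinable to \<open>u\<close> is open, and so is its complement: a
  point and its neighbours in a coordinate ball are connected by segments, along which paths from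
  \<open>u\<close> extend in either direction.\<close>

lemma joinable_connected:
  assumes "connected (UNIV :: 'x set)"
  shows "joinable u v"
proof -
  have nbhd: "\<exists>U. open U \<and> v \<in> U \<and> (\<forall>w\<in>U. joinable u v \<longleftrightarrow> joinable u w)" for v
  proof -
    obtain c where c: "c \<in> charts_at A v" by (rule charts_at_nonempty)
    then have cA: "c \<in> A" "v \<in> dom_chart c" by (auto simp: charts_at_def)
    then obtain e where e: "0 < e" "ball (map_chart c v) e \<subseteq> img_chart c"
      using chart_open(2) [of c] open_contains_ball chart_inv(4) by (metis is_chart)
    define U where "U = dom_chart c \<inter> map_chart c -` ball (map_chart c v) e"
    have "open U" unfolding U_def using cA by (intro chart_preimage_open) auto
    moreover have "joinable u v \<longleftrightarrow> joinable u w" if "w \<in> U" for w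
    proof -
      have "map_chart c v \<in> ball (map_chart c v) e" "map_chart c w \<in> ball (map_chart c v) e"
        using e that by (auto simp: U_def)
      then have "closed_segment (map_chart c v) (map_chart c w) \<subseteq> img_chart c"
        using e(2) closed_segment_subset [OF _ _ convex_ball] by blast
      then show ?thesis
        using joinable_extend [of u v c w] joinable_extend [of u w c v] that cA
        by (auto simp: U_def closed_segment_commute)
    qed
    ultimately show ?thesis
      using cA e by (intro exI [of _ U]) (auto simp: U_def)
  qed
  have "open {v. joinable u v}"
    by (subst open_subopen) (metis nbhd mem_Collect_eq subsetI)
  moreover have "open (- {v. joinable u v})"
    by (subst open_subopen) (metis nbhd ComplD ComplI mem_Collect_eq subsetI)
  moreover have "\<forall>T :: 'x set. open T \<and> closed T \<longrightarrow> T = {} \<or> T = UNIV"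
    using connected_clopen [of "UNIV :: 'x set"] assms by simp
  ultimately have "{v. joinable u v} = {} \<or> {v. joinable u v} = UNIV"
    unfolding closed_def by blast
  then show ?thesis
    using joinable_refl [of u] by auto
qed

end


section \<open>The Finsler distance\<close>

locale finsler = c1_manifold A for A :: "('x::t2_space, 'e::banach) chart set" +
  fixes N :: "'x \<Rightarrow> ('x, 'e) tangent \<Rightarrow> real"
  assumes finsler_structure: "finsler_structure A N" and conn: "connected (UNIV :: 'x set)"
begin

section \<open>Local norms and the length of paths\<close>

lemma renorming_chart:
  "c \<in> charts_at A x \<Longrightarrow> renorming (\<lambda>v. N x (dinv_chart A c x v))"
  using finsler_structure unfolding finsler_structure_def by unfold_locales blast+

lemma continuous_in_chart:
  "c \<in> A \<Longrightarrow> continuous_on (dom_chart c \<times> UNIV) (\<lambda>(x, v). N x (dinv_chart A c x v))"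
  using finsler_structure unfolding finsler_structure_def by blast

lemma almost_constant:
  assumes "c \<in> charts_at A x" "1 < k"
  obtains U where "open U" "x \<in> U" "U \<subseteq> dom_chart c"
    "\<And>u v. u \<in> U \<Longrightarrow> N x (dinv_chart A c x v) \<le> k * N u (dinv_chart A c u v)"
    "\<And>u v. u \<in> U \<Longrightarrow> N u (dinv_chart A c u v) \<le> k * N x (dinv_chart A c x v)"
proof -
  have "\<exists>U. open U \<and> x \<in> U \<and> U \<subseteq> dom_chart c \<and>
         (\<forall>u\<in>U. \<forall>v.
            1 / (1 + (k - 1)) * N x (dinv_chart A c x v) \<le> N u (dinv_chart A c u v) \<and>
            N u (dinv_chart A c u v) \<le> (1 + (k - 1)) * N x (dinv_chart A c x v))"
    using finsler_structure assms unfolding finsler_structure_def by (meson diff_gt_0_iff_gt)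
  then show ?thesis
    using that assms by (simp add: field_simps) blast
qed

definition speed :: "real \<Rightarrow> real \<Rightarrow> (real \<Rightarrow> 'x) \<Rightarrow> real \<Rightarrow> real"
  where "speed a b \<sigma> t = N (\<sigma> t) (velocity A a b \<sigma> t)"

lemma path_len_eq: "path_len A N a b \<sigma> = integral {a..b} (speed a b \<sigma>)"
  unfolding path_len_def speed_def ..

lemma speed_eq:
  assumes "C1_path A a b \<sigma>" "t \<in> {a..b}" "c \<in> charts_at A (\<sigma> t)"
    "(map_chart c \<circ> \<sigma> has_vector_derivative D) (at t within {a..b})"
  shows "speed a b \<sigma> t = N (\<sigma> t) (dinv_chart A c (\<sigma> t) D)"
  unfolding speed_def using velocity_eq [OF assms] by simp

lemma speed_nonneg:
  assumes \<sigma>: "C1_path A a b \<sigma>" and t: "t \<in> {a..b}"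
  shows "0 \<le> speed a b \<sigma> t"
proof -
  obtain c where c: "c \<in> charts_at A (\<sigma> t)" by (rule charts_at_nonempty)
  then obtain D where "(map_chart c \<circ> \<sigma> has_vector_derivative D) (at t within {a..b})"
    using \<sigma> t unfolding C1_path_def charts_at_def by blast
  from speed_eq [OF \<sigma> t c this] show ?thesis
    using renorming.nonneg [OF renorming_chart [OF c]] by simp
qed

text \<open>Makes \<open>path_len\<close> the integral of an integrable function, and the arc length
  differentiable in time.\<close>

lemma continuous_on_speed:
  assumes \<sigma>: "C1_path A a b \<sigma>"
  shows "continuous_on {a..b} (speed a b \<sigma>)"
  unfolding continuous_on_eq_continuous_within
proof
  fix t assume t: "t \<in> {a..b}"
  have cont: "continuous_on {a..b} \<sigma>" using \<sigma> by (simp add: C1_path_def)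
  obtain c where c: "c \<in> charts_at A (\<sigma> t)" by (rule charts_at_nonempty)
  then have cA: "c \<in> A" "\<sigma> t \<in> dom_chart c" by (auto simp: charts_at_def)
  let ?S = "{t \<in> {a..b}. \<sigma> t \<in> dom_chart c}"
  obtain D where D: "continuous_on ?S D"
    "\<And>t. t \<in> {a..b} \<Longrightarrow> \<sigma> t \<in> dom_chart c \<Longrightarrow>
        (map_chart c \<circ> \<sigma> has_vector_derivative D t) (at t within {a..b})"
    using \<sigma> cA unfolding C1_path_def by blast
  have "continuous_on ?S (\<lambda>t. (\<lambda>(x, v). N x (dinv_chart A c x v)) (\<sigma> t, D t))"
    by (rule continuous_on_compose2 [OF continuous_in_chart [OF cA(1)]])
      (auto intro!: continuous_on_Pair intro: D(1)[simplified] continuous_on_subset [OF cont])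
  then have "continuous_on ?S (speed a b \<sigma>)"
    by (rule continuous_on_eq) (use speed_eq [OF \<sigma> _ _ D(2)] cA in \<open>auto simp: charts_at_def\<close>)
  then have "continuous (at t within ?S) (speed a b \<sigma>)"
    using t cA by (simp add: continuous_on_eq_continuous_within)
  \<comment> \<open>The times spent in the chart form a relatively open set, so continuity at
    \<open>t\<close> within \<open>?S\<close> is continuity within the whole interval.\<close>
  moreover have "?S = {a..b} \<inter> \<sigma> -` dom_chart c" by auto
  then obtain T where T: "open T" "?S = {a..b} \<inter> T"
    using continuous_openin_preimage_gen [OF cont chart_open(1) [OF is_chart [OF cA(1)]]]
    unfolding openin_open by metis
  have "at t within {a..b} = at t within ?S"
    by (rule at_within_nhd [of _ T]) (use T t cA in auto)
  ultimately show "continuous (at t within {a..b}) (speed a b \<sigma>)"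
    by simp
qed

lemma path_len_nonneg: "C1_path A a b \<sigma> \<Longrightarrow> 0 \<le> path_len A N a b \<sigma>"
  unfolding path_len_eq
  by (intro integral_nonneg integrable_continuous_real continuous_on_speed speed_nonneg)

section \<open>The distance and its comparison with norms in coordinates\<close>

lemma finsler_dist_le:
  assumes "C1_path A a b \<sigma>"
  shows "finsler_dist A N (\<sigma> a) (\<sigma> b) \<le> path_len A N a b \<sigma>"
  unfolding finsler_dist_def
  by (rule cInf_lower) (use assms path_len_nonneg in \<open>auto intro!: bdd_belowI [of _ 0]\<close>)

text \<open>Without this, \<open>finsler_dist\<close> could be \<open>Inf {}\<close>, an unspecified real number.\<close>

lemma paths_nonempty:
  "{path_len A N a b \<sigma> | a b \<sigma>. C1_path A a b \<sigma> \<and> \<sigma> a = u \<and> \<sigma> b = u'} \<noteq> {}"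
  using joinable_connected [OF conn, of u u'] unfolding joinable_def by blast

lemma finsler_dist_nonneg: "0 \<le> finsler_dist A N u u'"
  unfolding finsler_dist_def by (rule cInf_greatest [OF paths_nonempty]) (auto simp: path_len_nonneg)

lemma finsler_dist_less:
  assumes "finsler_dist A N u u' < l"
  obtains a b \<sigma> where "C1_path A a b \<sigma>" "\<sigma> a = u" "\<sigma> b = u'" "path_len A N a b \<sigma> < l"
  using cInf_lessD [OF paths_nonempty assms [unfolded finsler_dist_def]] that by blast

text \<open>Upper estimate: the straight segment in coordinates, run over unit time, is a competing
  path of speed at most \<open>m\<close>.\<close>

lemma finsler_dist_segment_le:
  assumes c: "c \<in> A"
    and seg: "\<And>z. z \<in> closed_segment z0 z1 \<Longrightarrow> z \<in> img_chart c \<and>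
      N (inv_chart c z) (dinv_chart A c (inv_chart c z) (z1 - z0)) \<le> m"
  shows "finsler_dist A N (inv_chart c z0) (inv_chart c z1) \<le> m"
proof -
  define \<eta> where "\<eta> t = z0 + t *\<^sub>R (z1 - z0)" for t
  have \<eta>: "\<eta> t \<in> closed_segment z0 z1" if "t \<in> {0..1}" for t
    unfolding in_segment \<eta>_def using that by (intro exI [of _ t]) (simp add: algebra_simps)
  have \<eta>_deriv: "(\<eta> has_vector_derivative z1 - z0) (at t within {0..1})" for t
    unfolding \<eta>_def by (auto intro!: derivative_eq_intros)
  define \<sigma> where "\<sigma> t = inv_chart c (\<eta> t)" for t
  have \<sigma>: "C1_path A 0 1 \<sigma>"
    unfolding \<sigma>_def using c \<eta> seg by (intro C1_path_in_chart [OF _ _ \<eta>_deriv]) auto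
  have "speed 0 1 \<sigma> t \<le> m" if t: "t \<in> {0..1}" for t
  proof -
    have img: "\<eta> s \<in> img_chart c" if "s \<in> {0..1}" for s using \<eta> [OF that] seg by blast
    have "(map_chart c \<circ> \<sigma> has_vector_derivative z1 - z0) (at t within {0..1})"
      by (rule has_vector_derivative_transform [OF t _ \<eta>_deriv]) (use img c in \<open>simp add: \<sigma>_def\<close>)
    moreover have "c \<in> charts_at A (\<sigma> t)"
      using img [OF t] c by (simp add: charts_at_def \<sigma>_def)
    ultimately have "speed 0 1 \<sigma> t = N (\<sigma> t) (dinv_chart A c (\<sigma> t) (z1 - z0))"
      using speed_eq [OF \<sigma> t] by blast
    then show ?thesis
      using seg [OF \<eta> [OF t]] by (simp add: \<sigma>_def)
  qed
  then have "integral {0..1} (speed 0 1 \<sigma>) \<le> integral {0..1::real} (\<lambda>_. m)"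
    by (intro integral_le integrable_continuous_real continuous_on_speed \<sigma>) auto
  then have "path_len A N 0 1 \<sigma> \<le> m"
    by (simp add: path_len_eq)
  moreover have "\<sigma> 0 = inv_chart c z0" "\<sigma> 1 = inv_chart c z1"
    by (simp_all add: \<sigma>_def \<eta>_def)
  ultimately show ?thesis
    using finsler_dist_le [OF \<sigma>] by simp
qed

lemma finsler_dist_refl: "finsler_dist A N u u \<le> 0"
proof -
  obtain c where c: "c \<in> charts_at A u" by (rule charts_at_nonempty)
  then have cA: "c \<in> A" "u \<in> dom_chart c" by (auto simp: charts_at_def)
  have "finsler_dist A N (inv_chart c (map_chart c u)) (inv_chart c (map_chart c u)) \<le> 0"
    by (rule finsler_dist_segment_le)
      (use cA c renorming.zero [OF renorming_chart [OF c]] in auto)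
  then show ?thesis using cA by simp
qed

text \<open>A path cannot leave a ball in a chart without being long. As the image of a closed ball need
  not be closed in the manifold, this uses that the coordinates of the path converge at the exit
  time (its length being finite) and that the manifold is Hausdorff.\<close>

lemma short_path_stays_in_chart_ball:
  assumes p: "renorming p" and c: "c \<in> A" and k: "0 \<le> k"
    and \<sigma>: "C1_path A a b \<sigma>" and \<sigma>a: "\<sigma> a \<in> dom_chart c"
    and ball: "\<And>z v. p (z - map_chart c (\<sigma> a)) < s \<Longrightarrow> z \<in> img_chart c \<and>
      p v \<le> k * N (inv_chart c z) (dinv_chart A c (inv_chart c z) v)"
    and len: "k * path_len A N a b \<sigma> < s"
  shows "\<sigma> b \<in> dom_chart c \<and> p (map_chart c (\<sigma> b) - map_chart c (\<sigma> a)) \<le> k * path_len A N a b \<sigma>"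
proof -
  interpret p: renorming p by fact
  have ab: "a < b" and cont: "continuous_on {a..b} \<sigma>"
    using \<sigma> by (auto simp: C1_path_def)
  define F where "F = map_chart c \<circ> \<sigma>"
  define \<Phi> where "\<Phi> t = integral {a..t} (speed a b \<sigma>)" for t
  have \<Phi>: "(\<Phi> has_real_derivative speed a b \<sigma> t) (at t within {a..b})" if "t \<in> {a..b}" for t
    unfolding \<Phi>_def using that by (intro integral_has_real_derivative continuous_on_speed \<sigma>)
  have \<Phi>_ab: "\<Phi> a = 0" "\<Phi> b = path_len A N a b \<sigma>"
    by (simp_all add: \<Phi>_def path_len_eq)
  have \<Phi>_mono: "\<Phi> t \<le> \<Phi> t'" if "t \<in> {a..b}" "t' \<in> {a..b}" "t \<le> t'" for t t'
    unfolding \<Phi>_def using that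
    by (intro integral_subset_le integrable_continuous_real continuous_on_subset [OF continuous_on_speed [OF \<sigma>]])
      (auto intro: speed_nonneg [OF \<sigma>])
  define G where "G = {u \<in> dom_chart c. p (map_chart c u - F a) < s}"
  have "G = dom_chart c \<inter> map_chart c -` {z. p (z - F a) < s}"
    by (auto simp: G_def)
  then have "open G"
    using chart_preimage_open [OF is_chart [OF c] p.open_ball] by simp
  have "0 < s"
    using len k path_len_nonneg [OF \<sigma>] mult_nonneg_nonneg [of k "path_len A N a b \<sigma>"] by linarith
  then have \<sigma>a_G: "\<sigma> a \<in> G"
    using \<sigma>a by (simp add: G_def F_def)
  have bound: "p (F t' - F t) \<le> k * \<Phi> t' - k * \<Phi> t"
    if tt': "a \<le> t" "t \<le> t'" "t' \<le> b" and G: "\<And>r. r \<in> {t..t'} \<Longrightarrow> \<sigma> r \<in> G" for t t'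
  proof -
    obtain D where D: "\<And>t. t \<in> {a..b} \<Longrightarrow> \<sigma> t \<in> dom_chart c \<Longrightarrow>
        (F has_vector_derivative D t) (at t within {a..b})"
      using \<sigma> c unfolding C1_path_def F_def by blast
    show ?thesis
    proof (rule p.mean_value_bound [where F' = D and G' = "\<lambda>r. k * speed a b \<sigma> r", OF tt'(2)])
      fix r assume r: "r \<in> {t..t'}"
      then have r': "r \<in> {a..b}" and dom: "\<sigma> r \<in> dom_chart c" and sub: "{t..t'} \<subseteq> {a..b}"
        and pr: "p (F r - F a) < s"
        using tt' G [of r] by (auto simp: G_def F_def)
      show "(F has_vector_derivative D r) (at r within {t..t'})"
        by (rule has_vector_derivative_within_subset [OF D [OF r' dom] sub])
      show "((\<lambda>r. k * \<Phi> r) has_real_derivative k * speed a b \<sigma> r) (at r within {t..t'})"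
        by (intro DERIV_cmult DERIV_subset [OF \<Phi> [OF r'] sub])
      have "p (D r) \<le> k * N (inv_chart c (F r)) (dinv_chart A c (inv_chart c (F r)) (D r))"
        using ball [of "F r" "D r"] pr by (simp add: F_def)
      also have "\<dots> = k * speed a b \<sigma> r"
        using speed_eq [OF \<sigma> r' _ D [OF r' dom, unfolded F_def]] dom c by (simp add: charts_at_def F_def)
      finally show "p (D r) \<le> k * speed a b \<sigma> r" .
    qed
  qed
  define good where "good t \<longleftrightarrow> (\<forall>r\<in>{a..t}. \<sigma> r \<in> G)" for t
  have good_bound: "p (F t - F a) \<le> k * \<Phi> t" if "t \<in> {a..b}" "good t" for t
    using bound [of a t] that by (simp add: good_def \<Phi>_ab)
  \<comment> \<open>Continuity method: the supremum \<open>t1\<close> of these times is itself good,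
    and as \<open>G\<close> is open it cannot lie before \<open>b\<close>.\<close>
  define T where "T = {t \<in> {a..b}. good t}"
  have aT: "a \<in> T" using ab \<sigma>a_G by (simp add: T_def good_def)
  have bdd: "bdd_above T" by (auto simp: T_def intro!: bdd_aboveI [of _ b])
  define t1 where "t1 = Sup T"
  have t1: "t1 \<in> {a..b}"
    unfolding t1_def using aT bdd by (auto simp: T_def intro: cSup_upper cSup_least)
  have before: "good t" if t: "a \<le> t" "t < t1" for t
  proof -
    obtain t' where "t' \<in> T" "t < t'"
      using t aT less_cSup_iff [OF _ bdd, of t] unfolding t1_def by blast
    then show ?thesis by (auto simp: T_def good_def)
  qed
  have "\<sigma> t1 \<in> G"
  proof (cases "t1 = a")
    case False
    then have "a < t1" using t1 by simp
    \<comment> \<open>Times strictly before \<open>t1\<close>, where the bound is already known,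
      increasing to \<open>t1\<close>.\<close>
    define u where "u n = t1 - (t1 - a) * inverse (real (Suc n))" for n
    have u: "a \<le> u n" "u n < t1" for n
    proof -
      have "inverse (real (Suc n)) \<le> 1" "0 < inverse (real (Suc n))"
        by (simp_all add: inverse_le_1_iff)
      then have "(t1 - a) * inverse (real (Suc n)) \<le> t1 - a" "0 < (t1 - a) * inverse (real (Suc n))"
        using \<open>a < t1\<close> by (auto intro: mult_left_le)
      then show "a \<le> u n" "u n < t1" by (auto simp: u_def)
    qed
    have u_mono: "u n \<le> u m" if "n \<le> m" for m n
      unfolding u_def using that \<open>a < t1\<close> by (intro diff_left_mono mult_left_mono) (auto simp: field_simps)
    have u_lim: "u \<longlonglongrightarrow> t1"
      unfolding u_def
      using tendsto_diff [OF tendsto_const tendsto_mult_left [OF LIMSEQ_inverse_real_of_nat], of t1 "t1 - a"]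
      by simp
    have u_ab: "u n \<in> {a..b}" for n
      using u [of n] t1 by auto
    have "continuous_on {a..b} \<Phi>"
      using \<Phi> by (meson DERIV_continuous continuous_on_eq_continuous_within)
    then have "(\<lambda>n. \<Phi> (u n)) \<longlonglongrightarrow> \<Phi> t1"
      using continuous_on_tendsto_compose u_lim t1 u_ab by fastforce
    then have "Cauchy (\<lambda>n. k * \<Phi> (u n))"
      by (rule LIMSEQ_imp_Cauchy [OF tendsto_mult_left])
    moreover have "p (F (u m) - F (u n)) \<le> \<bar>k * \<Phi> (u m) - k * \<Phi> (u n)\<bar>" if "n \<le> m" for m n
    proof -
      have "good (u m)" using before u by blast
      then have "p (F (u m) - F (u n)) \<le> k * \<Phi> (u m) - k * \<Phi> (u n)"
        using u(1) [of n] u_ab [of m] u_mono [OF that] by (intro bound) (auto simp: good_def)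
      then show ?thesis by linarith
    qed
    ultimately have "Cauchy (\<lambda>n. F (u n))"
      by (intro p.CauchyI)
    then obtain y where y: "(\<lambda>n. F (u n)) \<longlonglongrightarrow> y"
      using Cauchy_convergent convergent_def by blast
    \<comment> \<open>This bound is uniform and lies strictly below \<open>s\<close>, so the limit
      \<open>y\<close> of the coordinates remains inside the open ball and hence in the image of the
      chart.\<close>
    have "p (F (u n) - F a) \<le> k * path_len A N a b \<sigma>" for n
      using good_bound [OF u_ab before [OF u]] \<Phi>_mono [OF u_ab [of n], of b] ab k \<Phi>_ab
      by (smt (verit) atLeastAtMost_iff mult_left_mono u_ab)
    moreover have "(\<lambda>n. p (F (u n) - F a)) \<longlonglongrightarrow> p (y - F a)"
      by (intro p.tendsto tendsto_intros y)
    ultimately have py: "p (y - F a) \<le> k * path_len A N a b \<sigma>"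
      by (intro LIMSEQ_le_const2) auto
    then have y_img: "y \<in> img_chart c"
      using ball [of y] len by (simp add: F_def)
    have \<sigma>u: "\<sigma> (u n) \<in> dom_chart c" for n
      using before [OF u, of n] u by (auto simp: good_def G_def)
    have "(\<lambda>n. inv_chart c (F (u n))) \<longlonglongrightarrow> inv_chart c y"
      by (rule continuous_on_tendsto_compose [OF chart_continuous(2) y y_img])
        (use c \<sigma>u in \<open>auto simp: F_def\<close>)
    then have "(\<lambda>n. \<sigma> (u n)) \<longlonglongrightarrow> inv_chart c y"
      using c \<sigma>u by (simp add: F_def)
    moreover have "(\<lambda>n. \<sigma> (u n)) \<longlonglongrightarrow> \<sigma> t1"
      using continuous_on_tendsto_compose [OF cont u_lim t1] u_ab by simp
    ultimately have "\<sigma> t1 = inv_chart c y"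
      by (metis LIMSEQ_unique)
    then show ?thesis
      using y_img c py len by (simp add: G_def)
  qed (use \<sigma>a_G in simp)
  then have good_t1: "good t1"
    using before unfolding good_def by (metis atLeastAtMost_iff less_eq_real_def)
  have "t1 = b"
  proof (rule ccontr)
    assume "t1 \<noteq> b"
    then have "t1 < b" using t1 by simp
    have "\<forall>\<^sub>F t in at t1 within {a..b}. \<sigma> t \<in> G"
      using cont t1 \<open>\<sigma> t1 \<in> G\<close> \<open>open G\<close> unfolding continuous_on_def by (auto dest: topological_tendstoD)
    then obtain d where d: "0 < d" "\<And>t. t \<in> {a..b} \<Longrightarrow> t \<noteq> t1 \<Longrightarrow> dist t t1 < d \<Longrightarrow> \<sigma> t \<in> G"
      unfolding eventually_at by blast
    define t2 where "t2 = min b (t1 + d / 2)"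
    have t2: "t1 < t2" "t2 \<le> b" "t2 - t1 < d"
      using d \<open>t1 < b\<close> by (auto simp: t2_def)
    have "good t2"
      unfolding good_def
    proof
      fix r assume r: "r \<in> {a..t2}"
      show "\<sigma> r \<in> G"
      proof (cases "r \<le> t1")
        case True
        then show ?thesis using good_t1 r by (auto simp: good_def)
      next
        case False
        then show ?thesis using d(2) [of r] r t2 by (auto simp: dist_real_def)
      qed
    qed
    then have "t2 \<in> T" using t1 t2 by (simp add: T_def)
    then have "t2 \<le> t1" unfolding t1_def by (rule cSup_upper [OF _ bdd])
    then show False using t2 by simp
  qed
  then have "good b" using good_t1 by simp
  then show ?thesis
    using good_bound [of b] ab \<Phi>_ab by (auto simp: good_def G_def F_def)
qed

text \<open>Lower estimate. The infimum defining the distance need not be attained, so the bound for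
  paths is used with lengths below \<open>l\<close>, for each \<open>l\<close> slightly above the
  distance, and \<open>l\<close> is then decreased.\<close>

lemma finsler_dist_chart_ball:
  assumes p: "renorming p" and c: "c \<in> A" and k: "0 < k" and u: "u \<in> dom_chart c"
    and ball: "\<And>z v. p (z - map_chart c u) < s \<Longrightarrow> z \<in> img_chart c \<and>
      p v \<le> k * N (inv_chart c z) (dinv_chart A c (inv_chart c z) v)"
    and d: "k * finsler_dist A N u u' < s"
  shows "u' \<in> dom_chart c" "p (map_chart c u' - map_chart c u) \<le> k * finsler_dist A N u u'"
proof -
  have *: "u' \<in> dom_chart c \<and> p (map_chart c u' - map_chart c u) \<le> k * l"
    if l: "finsler_dist A N u u' < l" "k * l < s" for l
  proof -
    obtain a b \<sigma> where \<sigma>: "C1_path A a b \<sigma>" "\<sigma> a = u" "\<sigma> b = u'" "path_len A N a b \<sigma> < l"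
      using finsler_dist_less [OF l(1)] by metis
    then have le: "k * path_len A N a b \<sigma> \<le> k * l" using k by simp
    then have lt: "k * path_len A N a b \<sigma> < s" using l(2) by linarith
    have "u' \<in> dom_chart c \<and> p (map_chart c u' - map_chart c u) \<le> k * path_len A N a b \<sigma>"
      using short_path_stays_in_chart_ball [OF p c less_imp_le [OF k] \<sigma>(1) _ _ lt] \<sigma>(2,3) u ball by simp
    then show ?thesis
      using le by linarith
  qed
  have l: "finsler_dist A N u u' < s / k"
    using d k by (simp add: field_simps)
  then obtain l0 where l0: "finsler_dist A N u u' < l0" "l0 < s / k"
    using dense by blast
  then show "u' \<in> dom_chart c"
    using * [of l0] k by (simp add: field_simps)
  show "p (map_chart c u' - map_chart c u) \<le> k * finsler_dist A N u u'"
  proof (rule dense_ge_bounded [of _ s])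
    fix l assume "k * finsler_dist A N u u' < l" "l < s"
    then show "p (map_chart c u' - map_chart c u) \<le> l"
      using * [of "l / k"] k by (simp add: field_simps)
  qed fact
qed

section \<open>Dual norms and functionals in coordinates\<close>

lemma dual_norm_chart:
  assumes c: "c \<in> charts_at A x"
  shows "dual_norm A N x \<eta> = (SUP v\<in>{v. N x (dinv_chart A c x v) \<le> 1}. \<bar>\<eta> (dinv_chart A c x v)\<bar>)"
proof -
  have "{\<xi> \<in> tangent_space A x. N x \<xi> \<le> 1} = dinv_chart A c x ` {v. N x (dinv_chart A c x v) \<le> 1}"
    unfolding tangent_space_eq [OF c] by auto
  then show ?thesis
    by (simp add: dual_norm_def image_image)
qed

lemma cotangentI:
  assumes c: "c \<in> charts_at A x" and y: "bounded_linear y"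
  shows "(\<lambda>\<xi>. y (\<xi> c)) \<in> cotangent_space A x"
  unfolding cotangent_space_def
  using bounded_linear_compose [OF y bounded_linear_dinv_chart [OF _ c]] by auto

end


section \<open>Covering in Finsler manifolds\<close>

lemma tangent_op_dinv_chart:
  assumes "c1_manifold A" "c \<in> charts_at A x"
  shows "tangent_op A B c d x w T (dinv_chart A c x v) = dinv_chart B d w (blinfun_apply T v)"
proof -
  interpret c1_manifold A by fact
  show ?thesis
    using assms(2) by (simp add: tangent_op_def tangent_space_eq)
qed

text \<open>A derivative \<open>y\<close> of the norm has dual norm 1, so it is one of the
  functionals over which \<open>C_finsler\<close> is an infimum. Hence its composition with the
  operator has dual norm above \<open>\<kappa>\<close>, and some vector of the unit ball witnesses
  this.\<close>

lemma C_finsler_chart: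
  assumes X: "finsler A N" and Y: "finsler B M"
    and c: "c \<in> charts_at A x" and d: "d \<in> charts_at B w"
    and y: "((\<lambda>v. M w (dinv_chart B d w v)) has_derivative blinfun_apply y) (at y0)" and y0: "y0 \<noteq> 0"
    and T: "ereal \<kappa> < C_finsler A N B M x w (tangent_op A B c d x w T)"
  shows "\<exists>v. N x (dinv_chart A c x v) \<le> 1 \<and> \<kappa> < blinfun_apply y (blinfun_apply T v)"
proof -
  interpret X: finsler A N by fact
  interpret Y: finsler B M by fact
  define p where "p v = M w (dinv_chart B d w v)" for v
  define q where "q v = N x (dinv_chart A c x v)" for v
  interpret p: renorming p
    unfolding p_def using d by (rule Y.renorming_chart)
  interpret q: renorming q
    unfolding q_def using c by (rule X.renorming_chart)
  have "(p has_derivative blinfun_apply y) (at y0)"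
    using y by (simp add: p_def [abs_def])
  then have y_le: "blinfun_apply y v \<le> p v" and y_eq: "blinfun_apply y y0 = p y0" for v
    by (rule p.has_derivative_le)+
  have y_abs: "\<bar>blinfun_apply y v\<bar> \<le> p v" for v
    using y_le [of v] y_le [of "- v"] by (auto simp: blinfun.bilinear_simps abs_le_iff)
  define \<eta> where "\<eta> = (\<lambda>\<xi>. blinfun_apply y (\<xi> d))"
  have "\<eta> \<in> cotangent_space B w"
    unfolding \<eta>_def using d by (intro Y.cotangentI) (auto intro: blinfun.bounded_linear_right)
  moreover have "dual_norm B M w \<eta> = 1"
  proof -
    have "dual_norm B M w \<eta> = (SUP v\<in>{v. p v \<le> 1}. \<bar>blinfun_apply y v\<bar>)"
      using d by (simp add: Y.dual_norm_chart \<eta>_def p_def)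
    also have "\<dots> = 1"
    proof (rule cSup_eq_maximum)
      \<comment> \<open>The norm is attained at the normalized \<open>y0\<close>, because
        \<open>y\<close> takes the value \<open>p y0\<close> there before normalization.\<close>
      show "1 \<in> (\<lambda>v. \<bar>blinfun_apply y v\<bar>) ` {v. p v \<le> 1}"
        using p.pos [OF y0] y_eq
        by (intro image_eqI [of _ _ "(1 / p y0) *\<^sub>R y0"]) (auto simp: blinfun.bilinear_simps)
      show "t \<le> 1" if "t \<in> (\<lambda>v. \<bar>blinfun_apply y v\<bar>) ` {v. p v \<le> 1}" for t
        using that y_abs by (auto intro: order_trans)
    qed
    finally show ?thesis .
  qed
  ultimately have "C_finsler A N B M x w (tangent_op A B c d x w T)
      \<le> ereal (dual_norm A N x (\<eta> \<circ> tangent_op A B c d x w T))"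
    unfolding C_finsler_def by (intro INF_lower) simp
  also have "dual_norm A N x (\<eta> \<circ> tangent_op A B c d x w T) =
      (SUP v\<in>{v. q v \<le> 1}. \<bar>blinfun_apply y (blinfun_apply T v)\<bar>)"
    using c d by (simp add: X.dual_norm_chart \<eta>_def q_def tangent_op_dinv_chart [OF X.c1_manifold_axioms])
  finally have "ereal \<kappa> < ereal (SUP v\<in>{v. q v \<le> 1}. \<bar>blinfun_apply y (blinfun_apply T v)\<bar>)"
    by (rule less_le_trans [OF T])
  then have gt: "\<kappa> < (SUP v\<in>{v. q v \<le> 1}. \<bar>blinfun_apply y (blinfun_apply T v)\<bar>)"
    by (simp only: less_ereal.simps)
  have "\<exists>v. q v \<le> 1 \<and> \<kappa> < \<bar>blinfun_apply y (blinfun_apply T v)\<bar>"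
  proof (rule ccontr)
    assume "\<not> ?thesis"
    then have "(SUP v\<in>{v. q v \<le> 1}. \<bar>blinfun_apply y (blinfun_apply T v)\<bar>) \<le> \<kappa>"
      by (intro cSUP_least) (auto simp: not_less intro: exI [of _ 0])
    then show False using gt by simp
  qed
  then obtain v where v: "q v \<le> 1" "\<kappa> < \<bar>blinfun_apply y (blinfun_apply T v)\<bar>"
    by blast
  show ?thesis
  \<comment> \<open>The dual norm involves absolute values; the symmetry of the unit ball fixes the
    sign.\<close>
  proof (cases "0 \<le> blinfun_apply y (blinfun_apply T v)")
    case True
    then show ?thesis using v by (intro exI [of _ v]) (simp add: q_def)
  next
    case False
    then show ?thesis
      using v q.minus [of v] by (intro exI [of _ "- v"]) (simp add: q_def blinfun.bilinear_simps)
  qed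
qed

text \<open>Convexity and compactness are given in charts \<open>c1\<close>, \<open>d1\<close> that
  need not be \<open>c\<close>, \<open>d\<close>. Both pairs represent the same set
  \<open>Jf u\<close> of tangent operators, so each function \<open>v \<mapsto> y (T v)\<close>
  equals \<open>v \<mapsto> y1 (T1 (Q v))\<close> with a representative \<open>T1\<close> in the
  good charts. The map \<open>\<Theta>\<close> from \<open>T1\<close> to this function is linear and
  continuous, so it preserves both properties.\<close>

lemma strong_pseudo_jacobian_functionals:
  fixes y :: "'f::banach \<Rightarrow>\<^sub>L real" and Jf :: "'x::t2_space \<Rightarrow> (('x, 'e::banach) tangent \<Rightarrow> ('y::t2_space, 'f) tangent) set"
  assumes A: "c1_manifold A" and B: "c1_manifold B"
    and Jf: "strong_pseudo_jacobian_mapping A B f Jf"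
    and J: "jacobian_in_charts A B f Jf c d J" and u: "u \<in> dom_chart c"
  defines "S \<equiv> (\<lambda>T v. blinfun_apply y (blinfun_apply T v)) ` J (map_chart c u)"
  shows "compact S" and "\<And>s t a. s \<in> S \<Longrightarrow> t \<in> S \<Longrightarrow> 0 \<le> a \<Longrightarrow> a \<le> 1 \<Longrightarrow> (\<lambda>v. (1 - a) * s v + a * t v) \<in> S"
proof -
  interpret A: c1_manifold A by fact
  interpret B: c1_manifold B by fact
  obtain c1 d1 J1 where u1: "u \<in> dom_chart c1" and J1: "jacobian_in_charts A B f Jf c1 d1 J1"
    and strong: "\<And>z. z \<in> img_chart c1 \<Longrightarrow> convex (J1 z) \<and> compactin weak_operator_topology (J1 z)"
    using Jf unfolding strong_pseudo_jacobian_mapping_def by metis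
  have c: "c \<in> charts_at A u" "c1 \<in> charts_at A u"
    and d: "d \<in> charts_at B (f u)" "d1 \<in> charts_at B (f u)"
    using J J1 u u1 unfolding jacobian_in_charts_def charts_at_def by auto
  define K where "K = J1 (map_chart c1 u)"
  have K: "convex K" "compactin weak_operator_topology K"
    using strong [of "map_chart c1 u"] c u1 by (auto simp: K_def)
  have Jf_eq: "tangent_op A B c d u (f u) ` J (map_chart c u) = tangent_op A B c1 d1 u (f u) ` K"
    using J J1 u u1 unfolding jacobian_in_charts_def K_def by metis
  define Q where "Q v = dinv_chart A c u v c1" for v
  define y1 :: "'f \<Rightarrow>\<^sub>L real" where "y1 = Blinfun (\<lambda>w. blinfun_apply y (dinv_chart B d1 (f u) w d))"
  have y1: "blinfun_apply y1 w = blinfun_apply y (dinv_chart B d1 (f u) w d)" for w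
    unfolding y1_def using B.bounded_linear_dinv_chart [OF d(2,1)]
    by (subst bounded_linear_Blinfun_apply) (auto intro: bounded_linear_compose [OF blinfun.bounded_linear_right])
  define \<Theta> where "\<Theta> T1 = (\<lambda>v. blinfun_apply y1 (blinfun_apply T1 (Q v)))" for T1 :: "'e \<Rightarrow>\<^sub>L 'f"
  have same: "(\<lambda>v. blinfun_apply y (blinfun_apply T v)) = \<Theta> T1"
    if "tangent_op A B c d u (f u) T = tangent_op A B c1 d1 u (f u) T1" for T T1
  proof
    fix v
    have "dinv_chart B d (f u) (blinfun_apply T v) = tangent_op A B c1 d1 u (f u) T1 (dinv_chart A c u v)"
      using that tangent_op_dinv_chart [OF A c(1)] by metis
    also have "dinv_chart A c u v = dinv_chart A c1 u (Q v)"
      unfolding Q_def using c by (simp add: A.dinv_chart_trans)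
    also have "tangent_op A B c1 d1 u (f u) T1 \<dots> = dinv_chart B d1 (f u) (blinfun_apply T1 (Q v))"
      by (rule tangent_op_dinv_chart [OF A c(2)])
    finally have "blinfun_apply T v = dinv_chart B d1 (f u) (blinfun_apply T1 (Q v)) d"
      using d by (metis B.dinv_chart_same)
    then show "blinfun_apply y (blinfun_apply T v) = \<Theta> T1 v"
      by (simp add: \<Theta>_def y1)
  qed
  have S: "S = \<Theta> ` K"
  proof (intro antisym subsetI)
    fix s assume "s \<in> S"
    then obtain T where T: "T \<in> J (map_chart c u)" "s = (\<lambda>v. blinfun_apply y (blinfun_apply T v))"
      by (auto simp: S_def)
    then have "tangent_op A B c d u (f u) T \<in> tangent_op A B c1 d1 u (f u) ` K"
      using Jf_eq by blast
    then obtain T1 where "T1 \<in> K" "tangent_op A B c d u (f u) T = tangent_op A B c1 d1 u (f u) T1"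
      by (rule imageE) blast
    then show "s \<in> \<Theta> ` K" using same T by blast
  next
    fix s assume "s \<in> \<Theta> ` K"
    then obtain T1 where T1: "T1 \<in> K" "s = \<Theta> T1" by blast
    then have "tangent_op A B c1 d1 u (f u) T1 \<in> tangent_op A B c d u (f u) ` J (map_chart c u)"
      using Jf_eq by blast
    then obtain T where "T \<in> J (map_chart c u)" "tangent_op A B c1 d1 u (f u) T1 = tangent_op A B c d u (f u) T"
      by (rule imageE) blast
    then show "s \<in> S"
      unfolding S_def T1(2) using same [of T T1] by (intro image_eqI [of _ _ T]) simp_all
  qed
  \<comment> \<open>\<open>e\<close> is the map that defines the weak operator topology, and
    \<open>g\<close> picks out the coordinates \<open>(Q v, y1)\<close>; so
    \<open>\<Theta> = g \<circ> e\<close> is continuous without any estimate.\<close>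
  define e :: "('e \<Rightarrow>\<^sub>L 'f) \<Rightarrow> 'e \<times> ('f \<Rightarrow>\<^sub>L real) \<Rightarrow> real"
    where "e = (\<lambda>T (v, y). blinfun_apply y (blinfun_apply T v))"
  define g :: "('e \<times> ('f \<Rightarrow>\<^sub>L real) \<Rightarrow> real) \<Rightarrow> 'e \<Rightarrow> real"
    where "g = (\<lambda>\<phi> v. \<phi> (Q v, y1))"
  have "continuous_on UNIV g"
    unfolding g_def by (intro continuous_on_coordinatewise_then_product) simp
  then have "continuous_map euclidean euclidean g"
    by simp
  then have "continuous_map weak_operator_topology euclidean (g \<circ> e)"
    unfolding weak_operator_topology_def e_def by (rule continuous_map_pullback)
  moreover have "g \<circ> e = \<Theta>"
    by (auto simp: g_def e_def \<Theta>_def)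
  ultimately have "compactin euclidean (\<Theta> ` K)"
    using image_compactin [OF K(2)] by metis
  then show "compact S"
    unfolding S by simp
  fix s t and a :: real
  assume "s \<in> S" "t \<in> S" and a: "0 \<le> a" "a \<le> 1"
  then obtain T1 T2 where T: "T1 \<in> K" "T2 \<in> K" "s = \<Theta> T1" "t = \<Theta> T2"
    unfolding S by blast
  have "(\<lambda>v. (1 - a) * s v + a * t v) = \<Theta> ((1 - a) *\<^sub>R T1 + a *\<^sub>R T2)"
    by (simp add: T \<Theta>_def blinfun.bilinear_simps)
  moreover have "(1 - a) *\<^sub>R T1 + a *\<^sub>R T2 \<in> K"
    using K(1) T a by (simp add: convex_alt)
  ultimately show "(\<lambda>v. (1 - a) * s v + a * t v) \<in> S"
    unfolding S by blast
qed

text \<open>\<open>C_finsler_chart\<close> provides a direction that depends on \<open>T\<close>;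
  the minimax lemma exchanges the quantifiers, at the price of a non-strict inequality.\<close>

lemma strong_pseudo_jacobian_direction:
  fixes Jf :: "'x::t2_space \<Rightarrow> (('x, 'e::banach) tangent \<Rightarrow> ('y::t2_space, 'f::banach) tangent) set"
  assumes X: "finsler A N" and Y: "finsler B M"
    and Jf: "strong_pseudo_jacobian_mapping A B f Jf"
    and J: "jacobian_in_charts A B f Jf c d J" and x: "x \<in> dom_chart c" and u: "u \<in> dom_chart c"
    and y: "((\<lambda>v. M (f x) (dinv_chart B d (f x) v)) has_derivative blinfun_apply y) (at y0)" and y0: "y0 \<noteq> 0"
    and \<kappa>: "0 < \<kappa>"
    and reg: "\<And>T. T \<in> J (map_chart c u) \<Longrightarrow> ereal \<kappa> < C_finsler A N B M x (f x) (tangent_op A B c d x (f x) T)"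
  shows "\<exists>v. v \<noteq> 0 \<and> N x (dinv_chart A c x v) \<le> 1 \<and>
    (\<forall>T\<in>J (map_chart c u). \<kappa> \<le> blinfun_apply y (blinfun_apply T v))"
proof -
  interpret X: finsler A N by fact
  interpret Y: finsler B M by fact
  have c: "c \<in> charts_at A x" and d: "d \<in> charts_at B (f x)"
    using J x unfolding jacobian_in_charts_def charts_at_def by auto
  then have cA: "c \<in> A" by (simp add: charts_at_def)
  interpret q: renorming "\<lambda>v. N x (dinv_chart A c x v)"
    using c by (rule X.renorming_chart)
  define S where "S = (\<lambda>T v. blinfun_apply y (blinfun_apply T v)) ` J (map_chart c u)"
  have "map_chart c u \<in> img_chart c" using u cA by simp
  then have "J (map_chart c u) \<noteq> {}"
    using J unfolding jacobian_in_charts_def pseudo_jacobian_map_def pseudo_jacobian_def by blast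
  then have "S \<noteq> {}" by (simp add: S_def)
  note S = strong_pseudo_jacobian_functionals
    [OF X.c1_manifold_axioms Y.c1_manifold_axioms Jf J u, where y = y, folded S_def]
  have "\<exists>v\<in>{v. N x (dinv_chart A c x v) \<le> 1}. \<forall>s\<in>S. \<kappa> \<le> s v"
  proof (rule minimax_compact_functionals [OF S(1) \<open>S \<noteq> {}\<close> _ S(2) q.convex_unit_ball])
    show "linear s" if "s \<in> S" for s
      using that unfolding S_def
      by (auto intro!: bounded_linear.linear bounded_linear_compose [OF blinfun.bounded_linear_right]
          blinfun.bounded_linear_right)
    show "\<exists>v\<in>{v. N x (dinv_chart A c x v) \<le> 1}. \<kappa> < s v" if "s \<in> S" for s
      using that C_finsler_chart [OF X Y c d y y0 reg] unfolding S_def by blast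
  qed
  then obtain v where v: "N x (dinv_chart A c x v) \<le> 1" "\<And>s. s \<in> S \<Longrightarrow> \<kappa> \<le> s v"
    by blast
  then have *: "\<kappa> \<le> blinfun_apply y (blinfun_apply T v)" if "T \<in> J (map_chart c u)" for T
    using that unfolding S_def by blast
  \<comment> \<open>Zero is excluded because \<open>\<kappa>\<close> is positive and some
    \<open>T\<close> exists.\<close>
  have "v \<noteq> 0"
    using * \<open>J (map_chart c u) \<noteq> {}\<close> \<kappa> by (fastforce simp: blinfun.bilinear_simps)
  then show ?thesis using v(1) * by blast
qed

text \<open>Two one-sided comparisons enter: near \<open>x\<close>, distances in \<open>X\<close>
  are at most \<open>k\<close> times \<open>q\<close>-distances, and \<open>p\<close>-distances are
  at most \<open>k\<close> times those in \<open>Y\<close>. Hence a rate \<open>\<kappa>'\<close>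
  for \<open>g\<close> in coordinates becomes the rate \<open>\<kappa>' / (k * k)\<close> for
  \<open>f\<close>, which exceeds \<open>\<alpha>\<close>.\<close>

lemma finsler_covering:
  fixes f :: "'x::t2_space \<Rightarrow> 'y::t2_space"
    and J :: "'e::banach \<Rightarrow> ('e \<Rightarrow>\<^sub>L 'f::banach) set"
  assumes X: "finsler A N" and Y: "finsler B M" and smooth: "smooth_norm B M"
    and lip: "locally_lipschitz A N B M f"
    and c: "c \<in> charts_at A x" and d: "d \<in> charts_at B (f x)" and f_dom: "f ` dom_chart c \<subseteq> dom_chart d"
    and J: "pseudo_jacobian_map (img_chart c) (map_chart d \<circ> f \<circ> inv_chart c) J"
    and "0 < R"
    and reg: "\<And>u y y0. u \<in> dom_chart c \<Longrightarrow> u \<in> finsler_ball A N x R \<Longrightarrow> y0 \<noteq> 0 \<Longrightarrow>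
        ((\<lambda>v. M (f x) (dinv_chart B d (f x) v)) has_derivative blinfun_apply y) (at y0) \<Longrightarrow>
        \<exists>v. v \<noteq> 0 \<and> N x (dinv_chart A c x v) \<le> 1 \<and>
          (\<forall>T\<in>J (map_chart c u). \<kappa> \<le> blinfun_apply y (blinfun_apply T v))"
    and \<alpha>: "0 < \<alpha>" "\<alpha> < \<kappa>"
    and nontrivial: "(y0 :: 'f) \<noteq> 0"
  obtains W where "open W" "x \<in> W"
    "\<And>u r. u \<in> W \<Longrightarrow> 0 < r \<Longrightarrow> finsler_ball A N u r \<subseteq> W \<Longrightarrow>
      finsler_ball B M (f u) (\<alpha> * r) \<subseteq> f ` finsler_ball A N u r"
proof -
  interpret X: finsler A N by fact
  interpret Y: finsler B M by fact
  have cA: "c \<in> A" "x \<in> dom_chart c" and dB: "d \<in> B" "f x \<in> dom_chart d"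
    using c d by (auto simp: charts_at_def)
  define q where "q v = N x (dinv_chart A c x v)" for v
  define p where "p v = M (f x) (dinv_chart B d (f x) v)" for v
  interpret q: renorming q unfolding q_def using c by (rule X.renorming_chart)
  interpret p: renorming p unfolding p_def using d by (rule Y.renorming_chart)
  have p_smooth: "p differentiable (at v)" if "v \<noteq> 0" for v
    using smooth d that unfolding smooth_norm_def p_def by blast
  define g where "g = map_chart d \<circ> f \<circ> inv_chart c"
  define z0 where "z0 = map_chart c x"

  define \<kappa>' where "\<kappa>' = (\<alpha> + \<kappa>) / 2"
  have \<kappa>': "0 < \<kappa>'" "\<alpha> < \<kappa>'" "\<kappa>' < \<kappa>" using \<alpha> by (auto simp: \<kappa>'_def)
  \<comment> \<open>Chosen so that
    \<open>k * k \<le> 1 + 3 * \<epsilon> < \<kappa>' / \<alpha>\<close>; the denominator 4 gives a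
    strict inequality with 3.\<close>
  define \<epsilon> where "\<epsilon> = min 1 ((\<kappa>' / \<alpha> - 1) / 4)"
  have \<epsilon>: "0 < \<epsilon>" "\<epsilon> \<le> 1" "\<epsilon> < (\<kappa>' / \<alpha> - 1) / 3"
    using \<kappa>' \<alpha> by (auto simp: \<epsilon>_def field_simps min_def)
  define k where "k = 1 + \<epsilon>"
  have k: "1 < k" "0 < k" using \<epsilon> by (auto simp: k_def)
  have "\<epsilon> * \<epsilon> \<le> \<epsilon>" using \<epsilon> by (simp add: mult_left_le)
  moreover have "k * k = 1 + 2 * \<epsilon> + \<epsilon> * \<epsilon>" by (simp add: k_def algebra_simps)
  ultimately have "k * k < \<kappa>' / \<alpha>" using \<epsilon>(3) by simp
  then have kk: "k * k * \<alpha> < \<kappa>'" using \<alpha> by (simp add: field_simps)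

  obtain UX where UX: "open UX" "x \<in> UX" "UX \<subseteq> dom_chart c"
    "\<And>u v. u \<in> UX \<Longrightarrow> N u (dinv_chart A c u v) \<le> k * q v"
    using X.almost_constant [OF c k(1)] unfolding q_def by metis
  obtain UY where UY: "open UY" "f x \<in> UY" "UY \<subseteq> dom_chart d"
    "\<And>w v. w \<in> UY \<Longrightarrow> p v \<le> k * M w (dinv_chart B d w v)"
    using Y.almost_constant [OF d k(1)] unfolding p_def by metis
  obtain UL L where UL: "open UL" "x \<in> UL"
    "\<And>u u'. u \<in> UL \<Longrightarrow> u' \<in> UL \<Longrightarrow> finsler_dist B M (f u) (f u') \<le> L * finsler_dist A N u u'"
    using lip unfolding locally_lipschitz_def by metis
  have "open (map_chart d ` UY)" "map_chart d (f x) \<in> map_chart d ` UY"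
    using UY dB by (auto intro: chart_image_open)
  \<comment> \<open>Half of \<open>s\<close> is held in reserve: values of \<open>g\<close> will
    stay within \<open>s / 2\<close> of the centre, so that \<open>p\<close>-balls of radius
    \<open>s / 2\<close> around them still lie in the image of \<open>UY\<close>.\<close>
  then obtain s where s: "0 < s" "{y. p (y - map_chart d (f x)) < s} \<subseteq> map_chart d ` UY"
    by (rule p.ball_in_open)
  have gz0: "g z0 = map_chart d (f x)"
    using cA by (simp add: g_def z0_def)
  have g_cont: "continuous_on (img_chart c) g"
    using J by (simp add: pseudo_jacobian_map_def g_def)
  have "open (img_chart c \<inter> g -` {y. p (y - map_chart d (f x)) < s / 2})"
    by (rule continuous_open_preimage [OF g_cont _ p.open_ball]) (use cA in \<open>simp add: chart_open\<close>)
  moreover have "open (map_chart c ` (UX \<inter> UL))"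
    by (rule chart_image_open) (use cA UX UL in auto)
  ultimately have "open (img_chart c \<inter> g -` {y. p (y - map_chart d (f x)) < s / 2} \<inter> map_chart c ` (UX \<inter> UL))"
    by (rule open_Int)
  moreover have "z0 \<in> img_chart c \<inter> g -` {y. p (y - map_chart d (f x)) < s / 2} \<inter> map_chart c ` (UX \<inter> UL)"
    using gz0 cA UX UL s by (simp add: z0_def)
  ultimately obtain \<rho>1 where \<rho>1: "0 < \<rho>1" "{z. q (z - z0) < \<rho>1} \<subseteq>
      img_chart c \<inter> g -` {y. p (y - map_chart d (f x)) < s / 2} \<inter> map_chart c ` (UX \<inter> UL)"
    by (rule q.ball_in_open)
  \<comment> \<open>The bound \<open>R / k\<close> puts the points of this \<open>q\<close>-ball
    into the Finsler ball of radius \<open>R\<close>, where \<open>reg\<close> applies.\<close>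
  define \<rho>0 where "\<rho>0 = min \<rho>1 (R / k)"
  have \<rho>0: "0 < \<rho>0" "\<rho>0 \<le> \<rho>1" "k * \<rho>0 \<le> R"
    using \<rho>1 k \<open>0 < R\<close> by (auto simp: \<rho>0_def min_def field_simps)
  have in_ball: "z \<in> img_chart c" "p (g z - map_chart d (f x)) < s / 2" "inv_chart c z \<in> UX" "inv_chart c z \<in> UL"
    if "q (z - z0) < \<rho>0" for z
  proof -
    have *: "z \<in> img_chart c \<inter> g -` {y. p (y - map_chart d (f x)) < s / 2} \<inter> map_chart c ` (UX \<inter> UL)"
      using \<rho>1(2) \<rho>0 that by force
    then obtain u where "u \<in> UX" "u \<in> UL" "z = map_chart c u" by blast
    then show "inv_chart c z \<in> UX" "inv_chart c z \<in> UL"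
      using UX(3) cA by auto
    show "z \<in> img_chart c" "p (g z - map_chart d (f x)) < s / 2" using * by auto
  qed
  have dist_le: "finsler_dist A N (inv_chart c z) (inv_chart c z') \<le> k * q (z' - z)"
    if "q (z - z0) < \<rho>0" "q (z' - z0) < \<rho>0" for z z'
  proof (rule X.finsler_dist_segment_le [OF cA(1)])
    fix \<zeta> assume "\<zeta> \<in> closed_segment z z'"
    then have "q (\<zeta> - z0) < \<rho>0"
      using closed_segment_subset [OF _ _ q.convex_ball, of z z0 \<rho>0 z'] that by auto
    then show "\<zeta> \<in> img_chart c \<and> N (inv_chart c \<zeta>) (dinv_chart A c (inv_chart c \<zeta>) (z' - z)) \<le> k * q (z' - z)"
      using in_ball UX(4) by blast
  qed
  have dist_ge: "w \<in> dom_chart d" "p (map_chart d w - g z) \<le> k * finsler_dist B M (f (inv_chart c z)) w"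
    if z: "q (z - z0) < \<rho>0" and w: "k * finsler_dist B M (f (inv_chart c z)) w < s / 2" for z w
  proof -
    let ?u = "f (inv_chart c z)"
    have u: "?u \<in> dom_chart d" "map_chart d ?u = g z"
      using in_ball(3) [OF z] UX(3) f_dom by (auto simp: g_def)
    have "y \<in> img_chart d \<and> p v \<le> k * M (inv_chart d y) (dinv_chart B d (inv_chart d y) v)"
      if y: "p (y - map_chart d ?u) < s / 2" for y v
    proof -
      have "p (y - map_chart d (f x)) < s"
        using p.triangle_diff [of y "map_chart d (f x)" "g z"] in_ball(2) [OF z] y u by simp
      then obtain w where "w \<in> UY" "y = map_chart d w" using s by blast
      then show ?thesis using UY dB by auto
    qed
    then show "w \<in> dom_chart d" "p (map_chart d w - g z) \<le> k * finsler_dist B M ?u w"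
      using Y.finsler_dist_chart_ball [OF p.renorming_axioms dB(1) k(2) u(1) _ w] u(2) by auto
  qed

  \<comment> \<open>The Lipschitz condition for the distances becomes an estimate in coordinates;
    the sign of \<open>L\<close> is unknown, hence \<open>\<bar>L\<bar>\<close> below.\<close>
  have calm: "\<exists>K. \<forall>\<^sub>F z' in nhds z. norm (g z' - g z) \<le> K * norm (z' - z)"
    if z: "q (z - z0) < \<rho>0" for z
  proof -
    obtain a where a: "0 < a" "\<And>v. norm v \<le> a * p v" by (rule p.lower_bound) blast
    obtain b where b: "0 < b" "\<And>v. q v \<le> b * norm v" by (rule q.upper_bound) blast
    define l where "l = k * (\<bar>L\<bar> * k)"
    have l: "0 \<le> l" using k by (simp add: l_def)
    have ev: "\<forall>\<^sub>F z' in nhds z. q (z' - z0) < \<rho>0"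
      using eventually_nhds_in_open [OF q.open_ball, of z z0 \<rho>0] z by simp
    have "((\<lambda>z'. l * q (z' - z)) \<longlongrightarrow> l * q (z - z)) (nhds z)"
      by (intro tendsto_mult_left q.tendsto tendsto_diff tendsto_const filterlim_ident)
    then have "\<forall>\<^sub>F z' in nhds z. l * q (z' - z) < s / 2"
      by (rule order_tendstoD) (use s in simp)
    with ev have "\<forall>\<^sub>F z' in nhds z. norm (g z' - g z) \<le> (a * l * b) * norm (z' - z)"
    proof eventually_elim
      case (elim z')
      let ?u = "inv_chart c z" and ?u' = "inv_chart c z'"
      have "finsler_dist B M (f ?u) (f ?u') \<le> \<bar>L\<bar> * finsler_dist A N ?u ?u'"
        using UL(3) [OF in_ball(4) [OF z] in_ball(4) [OF elim(1)]]
          mult_right_mono [OF abs_ge_self X.finsler_dist_nonneg] by (rule order_trans)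
      also have "\<dots> \<le> \<bar>L\<bar> * (k * q (z' - z))"
        using dist_le [OF z elim(1)] by (intro mult_left_mono) auto
      finally have "k * finsler_dist B M (f ?u) (f ?u') \<le> k * (\<bar>L\<bar> * (k * q (z' - z)))"
        using k by (intro mult_left_mono) auto
      also have "\<dots> = l * q (z' - z)" by (simp add: l_def)
      finally have le: "k * finsler_dist B M (f ?u) (f ?u') \<le> l * q (z' - z)" .
      have "norm (g z' - g z) \<le> a * p (g z' - g z)" by (rule a)
      also have "p (g z' - g z) \<le> k * finsler_dist B M (f ?u) (f ?u')"
        using dist_ge(2) [OF z, of "f ?u'"] le elim by (simp add: g_def)
      also note le
      also have "l * q (z' - z) \<le> l * (b * norm (z' - z))"
        using l b by (intro mult_left_mono)
      finally show ?case using a by (simp add: mult.assoc)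
    qed
    then show ?thesis by blast
  qed
  have pj: "pseudo_jacobian g z (J z)" if "q (z - z0) < \<rho>0" for z
    using J in_ball(1) [OF that] by (simp add: pseudo_jacobian_map_def g_def)
  have dir: "\<exists>v. v \<noteq> 0 \<and> q v \<le> 1 \<and> (\<forall>T\<in>J z. \<kappa> \<le> blinfun_apply y (blinfun_apply T v))"
    if z: "q (z - z0) < \<rho>0" and y: "y1 \<noteq> 0" "(p has_derivative blinfun_apply y) (at y1)" for z y y1
  proof -
    have "finsler_dist A N x (inv_chart c z) \<le> k * q (z - z0)"
      using dist_le [of z0 z] z \<rho>0 cA by (simp add: z0_def)
    also have "\<dots> < k * \<rho>0" using z k by simp
    finally have "inv_chart c z \<in> finsler_ball A N x R"
      using \<rho>0 by (simp add: finsler_ball_def)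
    then show ?thesis
      using reg [of "inv_chart c z" y1 y] in_ball(1) [OF z] y cA unfolding p_def [abs_def] q_def by simp
  qed
  \<comment> \<open>A unit vector exists because \<open>dir\<close>, applied to the derivative of
    \<open>p\<close> at the given \<open>y0\<close>, produces a nonzero vector. It serves to bound
    \<open>r\<close>.\<close>
  obtain e0 where e0: "q e0 = 1"
  proof -
    obtain y' where y': "(p has_derivative y') (at y0)"
      using p_smooth [OF nontrivial] unfolding differentiable_def by blast
    then have "(p has_derivative blinfun_apply (Blinfun y')) (at y0)"
      using has_derivative_bounded_linear [OF y'] by (simp add: bounded_linear_Blinfun_apply)
    then have "\<exists>v. v \<noteq> (0 :: 'e)"
      using dir [OF _ nontrivial] \<rho>0 q.zero by (metis diff_self)
    then obtain v where "v \<noteq> (0 :: 'e)" ..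
    then show ?thesis
      by (intro that [of "(1 / q v) *\<^sub>R v"]) simp
  qed

  \<comment> \<open>\<open>\<rho>0 / 4\<close> leaves room for steps of size
    \<open>2 * \<rho>\<close> from points of \<open>W\<close>. The second term gives
    \<open>k * (\<alpha> * r) \<le> s / 2\<close> for all radii
    \<open>r \<le> 2 * k * \<rho>\<close>, so that \<open>dist_ge\<close> applies.\<close>
  define \<rho> where "\<rho> = min (\<rho>0 / 4) (s / (4 * (k * k * \<alpha>)))"
  have \<rho>: "0 < \<rho>" "4 * \<rho> \<le> \<rho>0" "2 * (k * k * \<alpha>) * \<rho> \<le> s / 2"
    using \<rho>0 s k \<alpha> by (auto simp: \<rho>_def min_def field_simps)
  define W where "W = dom_chart c \<inter> map_chart c -` {z. q (z - z0) < \<rho>}"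
  show ?thesis
  proof (rule that)
    show "open W"
      unfolding W_def using cA by (intro chart_preimage_open q.open_ball) simp
    show "x \<in> W" using cA \<rho> by (simp add: W_def z0_def)
    fix u r assume u: "u \<in> W" and r: "0 < r" and sub: "finsler_ball A N u r \<subseteq> W"
    define z where "z = map_chart c u"
    have z: "q (z - z0) < \<rho>" and uz: "inv_chart c z = u" "u \<in> dom_chart c"
      using u cA by (auto simp: W_def z_def)
    then have z\<rho>0: "q (z - z0) < \<rho>0" using \<rho> by simp
    \<comment> \<open>Otherwise the ball around \<open>u\<close> would reach a point at \<open>q\<close>-distance \<open>2\<rho>\<close> from \<open>z\<close>,
      which lies outside \<open>W\<close>.\<close>
    have r_le: "r \<le> 2 * k * \<rho>"
    proof (rule ccontr)
      assume "\<not> ?thesis"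
      define z' where "z' = z + (2 * \<rho>) *\<^sub>R e0"
      have qz': "q (z' - z) = 2 * \<rho>" using e0 \<rho> by (simp add: z'_def)
      have "q (z' - z0) < \<rho>0"
        using q.triangle_diff [of z' z0 z] qz' z \<rho> by simp
      then have "finsler_dist A N u (inv_chart c z') \<le> k * (2 * \<rho>)" and img: "z' \<in> img_chart c"
        using dist_le [OF z\<rho>0, of z'] in_ball(1) unfolding qz' uz(1) by simp_all
      then have "inv_chart c z' \<in> W"
        using sub \<open>\<not> r \<le> 2 * k * \<rho>\<close> by (auto simp: finsler_ball_def)
      then have "q (z' - z0) < \<rho>"
        using img cA by (simp add: W_def)
      then show False
        using q.triangle_diff [of z' z z0] q.minus_commute [of z z0] qz' z by simp
    qed
    show "finsler_ball B M (f u) (\<alpha> * r) \<subseteq> f ` finsler_ball A N u r"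
    proof
      fix w assume "w \<in> finsler_ball B M (f u) (\<alpha> * r)"
      then have w: "finsler_dist B M (f u) w < \<alpha> * r" by (simp add: finsler_ball_def)
      have 1: "k * finsler_dist B M (f u) w < k * (\<alpha> * r)"
        using w k by simp
      also have 2: "k * (\<alpha> * r) \<le> k * (\<alpha> * (2 * k * \<rho>))"
        using r_le k \<alpha> by (intro mult_left_mono) auto
      also have 3: "\<dots> = 2 * (k * k * \<alpha>) * \<rho>" by simp
      also note \<rho>(3)
      finally have "k * finsler_dist B M (f (inv_chart c z)) w < s / 2" using uz by simp
      note w_chart = dist_ge [OF z\<rho>0 this, unfolded uz]
      \<comment> \<open>The target is close enough to be reached within \<open>q\<close>-distance
        \<open>\<rho>0 - \<rho>\<close> of \<open>z\<close>, which keeps the search inside the ball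
        of radius \<open>\<rho>0\<close> around \<open>z0\<close>.\<close>
      have "p (map_chart d w - g z) < 2 * (k * k * \<alpha>) * \<rho>"
        using w_chart(2) 1 2 3 by linarith
      also have "\<dots> \<le> 2 * \<kappa>' * \<rho>"
        using kk \<rho> by simp
      also have "\<dots> \<le> \<kappa>' * (\<rho>0 - \<rho>)"
        using \<kappa>' \<rho> mult_left_mono [of "2 * \<rho>" "\<rho>0 - \<rho>" \<kappa>'] by (simp add: algebra_simps)
      finally have p_lt: "p (map_chart d w - g z) < \<kappa>' * (\<rho>0 - \<rho>)" .
      have shift: "q (\<zeta> - z0) < \<rho>0" if "q (\<zeta> - z) < \<rho>0 - \<rho>" for \<zeta>
        using q.triangle_diff [of \<zeta> z0 z] that z by simp
      have "\<exists>z'. \<kappa>' * q (z' - z) \<le> p (map_chart d w - g z) \<and> g z' = map_chart d w"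
      proof (rule covering_of_regular_pseudo_jacobian [where q = q and p = p and g = g and J = J
            and s = "\<rho>0 - \<rho>" and w = "map_chart d w" and \<kappa> = \<kappa> and \<kappa>' = \<kappa>', OF _ _ p_smooth])
        fix \<zeta> assume \<zeta>: "q (\<zeta> - z) < \<rho>0 - \<rho>"
        show "\<exists>K. \<forall>\<^sub>F z' in nhds \<zeta>. norm (g z' - g \<zeta>) \<le> K * norm (z' - \<zeta>)"
          by (rule calm [OF shift [OF \<zeta>]])
        show "pseudo_jacobian g \<zeta> (J \<zeta>)"
          by (rule pj [OF shift [OF \<zeta>]])
        show "\<exists>v. v \<noteq> 0 \<and> q v \<le> 1 \<and> (\<forall>T\<in>J \<zeta>. \<kappa> \<le> blinfun_apply y (blinfun_apply T v))"
          if "y1 \<noteq> 0" "(p has_derivative blinfun_apply y) (at y1)" for y y1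
          by (rule dir [OF shift [OF \<zeta>] that])
      qed (use q.renorming_axioms p.renorming_axioms \<kappa>' p_lt in blast)+
      then obtain z' where z': "\<kappa>' * q (z' - z) \<le> p (map_chart d w - g z)" "g z' = map_chart d w"
        by blast
      have "\<kappa>' * q (z' - z) < \<kappa>' * (\<rho>0 - \<rho>)"
        using z'(1) p_lt by simp
      then have z'\<rho>0: "q (z' - z0) < \<rho>0"
        using \<kappa>' by (intro shift) simp
      define u' where "u' = inv_chart c z'"
      have "u' \<in> dom_chart c"
        using in_ball(3) [OF z'\<rho>0] UX(3) by (auto simp: u'_def)
      then have "f u' \<in> dom_chart d" using f_dom by blast
      moreover have "map_chart d (f u') = map_chart d w"
        using z'(2) by (simp add: g_def u'_def)
      ultimately have "f u' = w"
        using w_chart(1) dB by (metis chart_inv(1) Y.is_chart)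
      have "\<kappa>' * finsler_dist A N u u' \<le> \<kappa>' * (k * q (z' - z))"
        using dist_le [OF z\<rho>0 z'\<rho>0] \<kappa>' uz by (simp add: u'_def)
      also have "\<dots> = k * (\<kappa>' * q (z' - z))" by simp
      also have "\<dots> \<le> k * (k * finsler_dist B M (f u) w)"
        using z'(1) w_chart(2) k by (intro mult_left_mono) auto
      also have "\<dots> < k * (k * (\<alpha> * r))"
        using w k by simp
      also have "\<dots> = (k * k * \<alpha>) * r" by simp
      also have "\<dots> < \<kappa>' * r"
        using kk r by simp
      finally have "u' \<in> finsler_ball A N u r"
        using \<kappa>' by (simp add: finsler_ball_def)
      with \<open>f u' = w\<close> show "w \<in> f ` finsler_ball A N u r" by blast
    qed
  qed
qed

text \<open>Chart maps are injective on their domains, so a chart domain is a single point here;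
  this point is open and closed, and the manifold is connected.\<close>

lemma (in finsler) trivial_model_space:
  assumes "\<And>v :: 'e. v = 0"
  shows "(UNIV :: 'x set) = {u}"
proof -
  obtain c where c: "c \<in> charts_at A u" by (rule charts_at_nonempty)
  then have cA: "c \<in> A" "u \<in> dom_chart c" by (auto simp: charts_at_def)
  have "w = u" if "w \<in> dom_chart c" for w
    using assms chart_inv(1) [OF is_chart [OF cA(1)]] cA(2) that by metis
  then have "dom_chart c = {u}" using cA by blast
  then have "open {u}"
    using chart_open(1) [OF is_chart [OF cA(1)]] by simp
  moreover have "\<forall>T :: 'x set. open T \<and> closed T \<longrightarrow> T = {} \<or> T = UNIV"
    using connected_clopen [of "UNIV :: 'x set"] conn by simp
  ultimately show ?thesis
    by (metis closed_singleton insert_not_empty)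
qed

theorem theorem16:
  fixes A :: "('x::t2_space, 'e::banach) chart set"
    and N :: "'x \<Rightarrow> ('x, 'e) tangent \<Rightarrow> real"
    and B :: "('y::t2_space, 'f::banach) chart set"
    and M :: "'y \<Rightarrow> ('y, 'f) tangent \<Rightarrow> real"
    and f :: "'x \<Rightarrow> 'y"
    and Jf :: "'x \<Rightarrow> (('x, 'e) tangent \<Rightarrow> ('y, 'f) tangent) set"
    and x :: 'x
    and c :: "('x, 'e) chart"
    and d :: "('y, 'f) chart"
    and J :: "'e \<Rightarrow> ('e \<Rightarrow>\<^sub>L 'f) set"
  assumes X: "finsler_manifold A N"
    and Y: "finsler_manifold B M" "smooth_norm B M"
    and f: "locally_lipschitz A N B M f"
    and Jf: "strong_pseudo_jacobian_mapping A B f Jf"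
    and charts: "x \<in> dom_chart c" "jacobian_in_charts A B f Jf c d J"
  shows "cov A N B M f x \<ge> finsler_regularity_index A N B M f c d J x"
proof -
  have X': "finsler A N" and Y': "finsler B M"
    using X Y(1) unfolding finsler_manifold_def by unfold_locales blast+
  interpret X: finsler A N by fact
  interpret Y: finsler B M by fact
  have c: "c \<in> charts_at A x" and d: "d \<in> charts_at B (f x)" and f_dom: "f ` dom_chart c \<subseteq> dom_chart d"
    and J: "pseudo_jacobian_map (img_chart c) (map_chart d \<circ> f \<circ> inv_chart c) J"
    using charts unfolding jacobian_in_charts_def charts_at_def by auto
  have open_near: "\<exists>W. open W \<and> x \<in> W \<and> (\<forall>u\<in>W. \<forall>r>0. finsler_ball A N u r \<subseteq> W \<longrightarrow>
      finsler_ball B M (f u) (\<alpha> * r) \<subseteq> f ` finsler_ball A N u r)"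
    if \<alpha>: "0 < \<alpha>" "ereal \<alpha> < finsler_regularity_index A N B M f c d J x" for \<alpha>
  \<comment> \<open>If the model space of \<open>Y\<close> is trivial, there is no nonzero vector at
    which to differentiate the norm; but then \<open>Y\<close> is a single point and every rate is
    admissible.\<close>
  proof (cases "\<exists>y0 :: 'f. y0 \<noteq> 0")
    case True
    then obtain y0 :: 'f where y0: "y0 \<noteq> 0" by blast
    obtain R where R: "0 < R" and less: "ereal \<alpha> < (INF T\<in>convex hull (\<Union>u\<in>finsler_ball A N x R. J (map_chart c u)).
         C_finsler A N B M x (f x) (tangent_op A B c d x (f x) T))"
      using \<alpha>(2) unfolding finsler_regularity_index_def less_SUP_iff by blast
    \<comment> \<open>\<open>finsler_covering\<close> loses a little of its constant, so one
      strictly above \<open>\<alpha>\<close> is inserted.\<close>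
    then obtain \<kappa> where \<kappa>: "\<alpha> < \<kappa>" "ereal \<kappa> < (INF T\<in>convex hull (\<Union>u\<in>finsler_ball A N x R. J (map_chart c u)).
         C_finsler A N B M x (f x) (tangent_op A B c d x (f x) T))"
      using ereal_dense2 [OF less] by auto
    have reg: "ereal \<kappa> < C_finsler A N B M x (f x) (tangent_op A B c d x (f x) T)"
      if "u \<in> finsler_ball A N x R" "T \<in> J (map_chart c u)" for u T
      using \<kappa>(2) by (rule less_INF_D) (use that in \<open>auto intro!: hull_inc\<close>)
    show ?thesis
      using finsler_covering [OF X' Y' Y(2) f c d f_dom J R _ \<alpha>(1) \<kappa>(1) y0]
        strong_pseudo_jacobian_direction [OF X' Y' Jf charts(2,1)] reg \<kappa>(1) \<alpha>(1)
      by (smt (verit))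
  next
    case False
    then have univ: "(UNIV :: 'y set) = {f u}" for u
      by (intro Y.trivial_model_space) blast
    have "finsler_ball B M (f u) (\<alpha> * r) \<subseteq> f ` finsler_ball A N u r" if "0 < r" for u r
    proof -
      have "u \<in> finsler_ball A N u r"
        using X.finsler_dist_refl [of u] that by (simp add: finsler_ball_def)
      then show ?thesis using univ [of u] by blast
    qed
    then show ?thesis by (intro exI [of _ UNIV]) simp
  qed
  have le_cov: "ereal \<alpha> \<le> cov A N B M f x"
    if \<alpha>: "0 < \<alpha>" "ereal \<alpha> < finsler_regularity_index A N B M f c d J x" for \<alpha>
    unfolding cov_def
    by (rule Sup_upper, rule insertI2, rule CollectI, rule exI [of _ \<alpha>])
      (simp only: \<alpha>(1) open_near [OF \<alpha>] simp_thms)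
  \<comment> \<open>Through the inserted 0 in \<open>cov\<close>, any \<open>\<alpha>\<close>
    strictly between the rate and the index is automatically positive.\<close>
  have cov_nonneg: "0 \<le> cov A N B M f x"
    unfolding cov_def by (intro Sup_upper) simp
  show ?thesis
  proof (rule ccontr)
    assume "\<not> ?thesis"
    then obtain \<alpha> where \<alpha>: "cov A N B M f x < ereal \<alpha>"
      "ereal \<alpha> < finsler_regularity_index A N B M f c d J x"
      using ereal_dense2 unfolding not_le by blast
    have "0 < ereal \<alpha>"
      using cov_nonneg \<alpha>(1) by (rule order_le_less_trans)
    then show False
      using le_cov [OF _ \<alpha>(2)] \<alpha>(1) by simp
  qed
qed

end
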